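(* For $0<\lambda<\infty$, let $$g(s)=\sum_{n=2}^\infty\frac{\psi(n)}{\log n}\,n^{-s},$$ where $\psi$ is the completely multiplicative function defined on the primes by $\psi(p)=\lambda p^{-1}\log p$. Then $\mathbf{T}_g$ is bounded on $\mathcal{H}^2$ if and only if $\lambda\le1$.
   Context: $\mathcal{H}^2$ is the Hilbert space of Dirichlet series $f(s)=\sum_{n\ge1}a_nn^{-s}$ with $\|f\|_{\mathcal{H}^2}^2=\sum_{n\ge1}|a_n|^2<\infty$. The Volterra operator with symbol $g$ is $\mathbf{T}_gf(s)=-\int_s^{+\infty}f(w)g'(w)\,dw$ (integral along the horizontal half-line from $s$, for $\mathrm{Re}\,s$ large enough), which is again a Dirichlet series. $\mathbf{T}_g$ is bounded on $\mathcal{H}^2$ if it maps $\mathcal{H}^2$ into itself with finite operator norm. *)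

theory Defs
  imports "HOL-Analysis.Analysis" "HOL-Computational_Algebra.Primes"
begin

definition completely_multiplicative :: "(nat \<Rightarrow> 'a::comm_semiring_1) \<Rightarrow> bool" where
  "completely_multiplicative \<psi> \<longleftrightarrow>
     \<psi> 1 = 1 \<and> (\<forall>m n. m > 0 \<longrightarrow> n > 0 \<longrightarrow> \<psi> (m * n) = \<psi> m * \<psi> n)"

(* The term n = 0 vanishes because 0 powr z = 0 for every z, so this is a sum over n \<ge> 1. *)
definition dirichlet_series :: "(nat \<Rightarrow> complex) \<Rightarrow> complex \<Rightarrow> complex" where
  "dirichlet_series a s = (\<Sum>n. a n * of_nat n powr (- s))"

(* An element of H2 is represented by its coefficients; requiring the unused coefficient at
   index 0 to be 0 makes the representation unique and the sums below range over n \<ge> 1. *)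
definition H2 :: "(nat \<Rightarrow> complex) set" where
  "H2 = {a. a 0 = 0 \<and> summable (\<lambda>n. (cmod (a n))\<^sup>2)}"

definition H2_norm :: "(nat \<Rightarrow> complex) \<Rightarrow> real" where
  "H2_norm a = sqrt (\<Sum>n. (cmod (a n))\<^sup>2)"

(* The horizontal half-line from s is parametrized by w = s + t with t \<ge> 0. *)
definition volterra_integrand ::
  "(complex \<Rightarrow> complex) \<Rightarrow> (complex \<Rightarrow> complex) \<Rightarrow> complex \<Rightarrow> real \<Rightarrow> complex" where
  "volterra_integrand g f s t = f (s + of_real t) * deriv g (s + of_real t)"

definition volterra :: "(complex \<Rightarrow> complex) \<Rightarrow> (complex \<Rightarrow> complex) \<Rightarrow> complex \<Rightarrow> complex" where
  "volterra g f s = - integral {0..} (volterra_integrand g f s)"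

(* T_g f is given by the integral only for Re s large enough, and T_g f being in H2 means that
   there it is the sum of a Dirichlet series with coefficients b in H2 (b is then unique).
   Integrability is demanded since the integral operator is total, with a default value. *)
definition volterra_bounded_on_H2 :: "(complex \<Rightarrow> complex) \<Rightarrow> bool" where
  "volterra_bounded_on_H2 g \<longleftrightarrow>
     (\<exists>C. \<forall>a\<in>H2. \<exists>b\<in>H2. H2_norm b \<le> C * H2_norm a \<and>
       (\<exists>\<sigma>. \<forall>s. Re s > \<sigma> \<longrightarrow>
          volterra_integrand g (dirichlet_series a) s integrable_on {0..} \<and>
          volterra g (dirichlet_series a) s = dirichlet_series b s))"

end

theory Submission
  imports Defs
begin

text \<open>
  Integrating termwise, \<open>T\<^sub>g\<close> maps the coefficients \<open>a\<close> to
  \<open>b N = (\<Sum>n | n dvd N \<and> n \<ge> 2. a (N / n) \<psi> n) / log N\<close>. What decides boundedness is that the primes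
  below \<open>log N\<close> alone contribute a factor \<open>\<Prod> (1 - \<lambda> log p / p)\<inverse>\<close>, which by Mertens' theorem is of
  the order \<open>(log N)\<^sup>\<lambda>\<close> and has to be compensated by \<open>1 / log N\<close>.

  For \<open>\<lambda> \<le> 1\<close> write \<open>N = m n\<close>. The terms with \<open>n > m\<close> are harmless because \<open>\<psi> n \<le> n powr (-5/8)\<close> and
  sums over divisors of \<open>N\<close> are \<open>O(N\<^sup>\<epsilon>)\<close>. For \<open>n \<le> m\<close> the Cauchy--Schwarz inequality is applied with
  multiplicative weights that favour the primes beyond \<open>log N\<close>; both resulting sums are \<open>O(log N)\<close>.

  For \<open>\<lambda> > 1\<close> take for \<open>a\<close> the indicator function of the divisors of \<open>Q = \<Prod>p\<le>y. p\<^sup>k\<close>. The average of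
  \<open>b N log N\<close> over \<open>N dvd Q\<close> is at least of the order \<open>y\<^sup>\<lambda>\<^sup>k\<^sup>/\<^sup>(\<^sup>k\<^sup>+\<^sup>1\<^sup>)\<close>, which for large \<open>k\<close> exceeds
  \<open>log Q = O(k y)\<close>.
\<close>

section \<open>Sums of multiplicative functions over smooth numbers and divisors\<close>

text \<open>The value lambda = 1 is critical: Mertens' estimate is needed with a bounded error,
  because an error in the exponent becomes a factor in front of log N. Higher-order terms of the
  Euler products cost only a constant, as the sum of (log p / p)^2 converges. Equal Cauchy-Schwarz
  weights fail on one side only. The sum over the divisors of \<open>N\<close> would still be O(log
  N), but exchanging the sums produces a sum over all \<open>n \<le> m\<close>, which outgrows every
  power of log m. Hence, for primes \<open>p > y\<close>, a factor p / y is shifted from one weight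
  to the other. Since \<open>y\<close> = log N depends on \<open>N\<close>, whereas the exchanged
  sum has \<open>m\<close> fixed, the case \<open>n \<le> m\<close> is treated separately: there log
  N lies between log m and 2 log m.\<close>

definition mult_ext :: "(nat \<Rightarrow> real) \<Rightarrow> nat \<Rightarrow> real" where
  "mult_ext f n = (\<Prod>p\<in>#prime_factorization n. f p)"

lemma nat_prime_induct [consumes 1, case_names one mult]:
  fixes n :: nat
  assumes "n > 0" "P 1" "\<And>p n. prime p \<Longrightarrow> n > 0 \<Longrightarrow> P n \<Longrightarrow> P (p * n)"
  shows "P n"
proof -
  have "n > 0 \<longrightarrow> P n"
    by (induction n rule: prime_divisors_induct) (use assms in auto)
  thus ?thesis using assms by simp
qed

lemma completely_multiplicative_mult_ext: "completely_multiplicative (mult_ext f)"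
  by (auto simp: completely_multiplicative_def mult_ext_def prime_factorization_mult)

lemma mult_ext_prime [simp]: "prime p \<Longrightarrow> mult_ext f p = f p"
  by (simp add: mult_ext_def prime_factorization_prime)

lemma mult_ext_times: "mult_ext f n * mult_ext g n = mult_ext (\<lambda>p. f p * g p) n"
  by (simp add: mult_ext_def prod_mset.distrib)

lemma completely_multiplicative_1: "completely_multiplicative h \<Longrightarrow> h (Suc 0) = 1"
  and completely_multiplicative_mult:
    "completely_multiplicative h \<Longrightarrow> m > 0 \<Longrightarrow> n > 0 \<Longrightarrow> h (m * n) = h m * h n"
  by (auto simp: completely_multiplicative_def)

lemma completely_multiplicative_nonneg:
  fixes h :: "nat \<Rightarrow> real"
  assumes "completely_multiplicative h" "\<And>p. prime p \<Longrightarrow> h p \<ge> 0" "n > 0"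
  shows "h n \<ge> 0"
  using assms(3)
proof (induction n rule: nat_prime_induct)
  case (mult p n)
  thus ?case using assms completely_multiplicative_mult[OF assms(1), of p n]
    by (simp add: prime_gt_0_nat)
qed (simp add: completely_multiplicative_1[OF assms(1)])

lemma completely_multiplicative_mono:
  fixes h h' :: "nat \<Rightarrow> real"
  assumes h: "completely_multiplicative h" and h': "completely_multiplicative h'"
    and "\<And>p. prime p \<Longrightarrow> h p \<ge> 0" "\<And>p. prime p \<Longrightarrow> h p \<le> h' p" "n > 0"
  shows "h n \<le> h' n"
  using assms(5)
proof (induction n rule: nat_prime_induct)
  case (mult p n)
  have "0 \<le> h n" using completely_multiplicative_nonneg[OF h] assms(3) mult by blast
  moreover have "0 \<le> h' p" using assms(3,4)[of p] mult by linarith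
  ultimately show ?case using mult assms(4)[of p]
      completely_multiplicative_mult[OF h, of p n] completely_multiplicative_mult[OF h', of p n]
    by (simp add: prime_gt_0_nat mult_mono)
qed (simp add: completely_multiplicative_1[OF h] completely_multiplicative_1[OF h'])

lemma completely_multiplicative_powr:
  "completely_multiplicative (\<lambda>n. real n powr c)"
  by (auto simp: completely_multiplicative_def powr_mult)

text \<open>The cutoff \<open>M\<close> keeps the sums finite, so that in the induction step the sum
  may be moved to the left-hand side; the bound does not depend on it.\<close>

lemma sum_smooth_le_euler_product:
  fixes h :: "nat \<Rightarrow> real"
  assumes h: "completely_multiplicative h" and nn: "\<And>p. prime p \<Longrightarrow> h p \<ge> 0"
    and "finite P" "\<And>p. p \<in> P \<Longrightarrow> prime p \<and> h p < 1"
  shows "(\<Sum>n | 0 < n \<and> n \<le> M \<and> prime_factors n \<subseteq> P. h n) \<le> (\<Prod>p\<in>P. 1 / (1 - h p))"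
  using assms(3,4)
proof (induction P rule: finite_induct)
  case empty
  have "{n. 0 < n \<and> n \<le> M \<and> prime_factors n \<subseteq> {}} \<subseteq> {1::nat}"
    by (auto simp: prime_factorization_empty_iff)
  hence "(\<Sum>n | 0 < n \<and> n \<le> M \<and> prime_factors n \<subseteq> {}. h n) \<le> sum h {1}"
    by (intro sum_mono2) (auto simp: completely_multiplicative_1[OF h])
  thus ?case using completely_multiplicative_1[OF h] by simp
next
  case (insert p P)
  have p: "prime p" "h p < 1" "h p \<ge> 0" using insert.prems nn by auto
  define S where "S = (\<lambda>P. {n. 0 < n \<and> n \<le> M \<and> prime_factors n \<subseteq> P})"
  have fin: "finite (S Q)" for Q
    by (rule finite_subset[of _ "{..M}"]) (auto simp: S_def)
  have nnh: "h n \<ge> 0" if "n > 0" for n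
    using completely_multiplicative_nonneg[OF h nn that] .
  \<comment> \<open>Splitting by divisibility by \<open>p\<close> bounds the sum over \<open>S (insert p P)\<close> by the one over
    \<open>S P\<close> plus \<open>h p\<close> times itself, which avoids expanding geometric series.\<close>
  have sub: "S (insert p P) \<subseteq> S P \<union> (*) p ` S (insert p P)"
  proof
    fix n assume n: "n \<in> S (insert p P)"
    show "n \<in> S P \<union> (*) p ` S (insert p P)"
    proof (cases "p dvd n")
      case False
      hence "p \<notin> prime_factors n" by auto
      thus ?thesis using n by (auto simp: S_def)
    next
      case True
      then obtain k where k: "n = p * k" by auto
      have "k \<in> S (insert p P)"
        using n p(1) unfolding k S_def
        by (auto simp: prime_factorization_mult prime_factorization_prime)
           (metis le_trans mult.commute mult_le_mono2 mult_numeral_1_right nat_mult_1_right numerals(1) prime_ge_1_nat)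
      thus ?thesis using k by auto
    qed
  qed
  have "sum h (S (insert p P)) \<le> sum h (S P \<union> (*) p ` S (insert p P))"
    using sub fin nnh prime_gt_0_nat[OF p(1)] by (intro sum_mono2) (auto simp: S_def)
  also have "\<dots> \<le> sum h (S P) + sum h ((*) p ` S (insert p P))"
    using fin nnh by (subst sum.union_inter[symmetric]) 
      (auto intro!: sum_nonneg simp: S_def)
  also have "sum h ((*) p ` S (insert p P)) = (\<Sum>n\<in>S (insert p P). h (p * n))"
    using p(1) by (subst sum.reindex) (auto intro: inj_onI simp: prime_gt_0_nat)
  also have "\<dots> = h p * sum h (S (insert p P))"
    unfolding sum_distrib_left using p(1)
    by (intro sum.cong) (auto simp: completely_multiplicative_mult[OF h] S_def prime_gt_0_nat)
  finally have "sum h (S (insert p P)) * (1 - h p) \<le> sum h (S P)"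
    by (simp add: algebra_simps)
  also have "sum h (S P) \<le> (\<Prod>p\<in>P. 1 / (1 - h p))"
    using insert unfolding S_def by auto
  finally show ?case using p insert.hyps
    by (simp add: S_def field_simps)
qed

text \<open>Primes in \<open>P\<close> contribute at most their full Euler factor. Splitting off one
  prime \<open>p\<close> outside \<open>P\<close> multiplies the divisor sum by at most
  \<open>1 + h p \<le> p powr c\<close>, and these powers multiply to at most
  \<open>N powr c\<close>. Large values of \<open>h\<close> outside \<open>P\<close> are therefore
  harmless.\<close>

lemma sum_divisors_le_euler_product:
  fixes h :: "nat \<Rightarrow> real"
  assumes h: "completely_multiplicative h" and nn: "\<And>p. prime p \<Longrightarrow> h p \<ge> 0"
    and P: "finite P" "\<And>p. p \<in> P \<Longrightarrow> prime p \<and> h p < 1"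
    and c: "\<And>p. prime p \<Longrightarrow> p \<notin> P \<Longrightarrow> h p \<le> c * ln (real p)"
    and "N > 0" and "c \<ge> 0"
  shows "(\<Sum>n | n dvd N. h n) \<le> (\<Prod>p\<in>P. 1 / (1 - h p)) * real N powr c"
  using \<open>N > 0\<close>
proof (induction N rule: less_induct)
  case (less N)
  define K where "K = (\<Prod>p\<in>P. 1 / (1 - h p))"
  have "K \<ge> 0" unfolding K_def using P by (intro prod_nonneg) (auto simp: less_imp_le)
  have nnh: "h n \<ge> 0" if "n > 0" for n
    using completely_multiplicative_nonneg[OF h nn that] .
  show ?case
  proof (cases "prime_factors N \<subseteq> P")
    case True
    have "{n. n dvd N} \<subseteq> {n. 0 < n \<and> n \<le> N \<and> prime_factors n \<subseteq> P}"
      using True less.prems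
      by (auto simp: dvd_imp_le intro!: Nat.gr0I dest: dvd_prime_factors[rotated])
    hence "(\<Sum>n | n dvd N. h n) \<le> (\<Sum>n | 0 < n \<and> n \<le> N \<and> prime_factors n \<subseteq> P. h n)"
      using nnh by (intro sum_mono2) auto
    also have "\<dots> \<le> K"
      unfolding K_def by (rule sum_smooth_le_euler_product[OF h nn P])
    also have "\<dots> \<le> K * real N powr c"
      using \<open>K \<ge> 0\<close> less.prems \<open>c \<ge> 0\<close>
      by (intro mult_le_cancel_left1[THEN iffD2]) (auto simp: ge_one_powr_ge_zero)
    finally show ?thesis by (simp add: K_def)
  next
    case False
    then obtain p where p: "p \<in> prime_factors N" "p \<notin> P" by auto
    then obtain M where M: "N = p * M" by (auto simp: prime_factors_dvd)
    have pp: "prime p" using p by auto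
    have "M > 0" "M < N" using M less.prems prime_gt_1_nat[OF pp] by auto
    have fin: "finite {n. n dvd M}" using \<open>M > 0\<close> by simp
    \<comment> \<open>The two sets may overlap; as \<open>h\<close> is nonnegative, this only
      weakens the upper bound.\<close>
    have sub: "{n. n dvd N} \<subseteq> {n. n dvd M} \<union> (*) p ` {n. n dvd M}"
    proof
      fix n assume "n \<in> {n. n dvd N}"
      hence n: "n dvd p * M" by (simp add: M)
      show "n \<in> {n. n dvd M} \<union> (*) p ` {n. n dvd M}"
      proof (cases "p dvd n")
        case True
        then obtain k where k: "n = p * k" by auto
        thus ?thesis using n pp by (auto simp: prime_gt_0_nat)
      next
        case False
        hence "coprime n p" using pp by (metis prime_imp_coprime coprime_commute)
        thus ?thesis using n by (auto simp: coprime_dvd_mult_right_iff)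
      qed
    qed
    have hpos: "0 \<le> h n" if "n dvd M" for n
      using that \<open>M > 0\<close> by (intro nnh) (auto intro!: Nat.gr0I)
    have "(\<Sum>n | n dvd N. h n) \<le> sum h ({n. n dvd M} \<union> (*) p ` {n. n dvd M})"
      using sub fin \<open>M > 0\<close> pp by (intro sum_mono2) (auto intro!: nnh Nat.gr0I)
    also have "\<dots> \<le> sum h {n. n dvd M} + sum h ((*) p ` {n. n dvd M})"
      using fin hpos by (subst sum.union_inter[symmetric]) (auto intro!: sum_nonneg)
    also have "sum h ((*) p ` {n. n dvd M}) = (\<Sum>n | n dvd M. h (p * n))"
      using pp by (subst sum.reindex) (auto intro: inj_onI simp: prime_gt_0_nat)
    also have "\<dots> = h p * sum h {n. n dvd M}"
      unfolding sum_distrib_left using pp \<open>M > 0\<close>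
      by (intro sum.cong refl completely_multiplicative_mult[OF h]) (auto simp: prime_gt_0_nat intro!: Nat.gr0I)
    also have "sum h {n. n dvd M} + h p * sum h {n. n dvd M} = (1 + h p) * sum h {n. n dvd M}"
      by (simp add: algebra_simps)
    also have "\<dots> \<le> real p powr c * (K * real M powr c)"
    proof (rule mult_mono)
      have "1 + h p \<le> 1 + c * ln (real p)" using c[OF pp p(2)] by simp
      also have "\<dots> \<le> exp (c * ln (real p))" by (rule exp_ge_add_one_self)
      also have "\<dots> = real p powr c" using prime_gt_0_nat[OF pp] by (simp add: powr_def)
      finally show "1 + h p \<le> real p powr c" .
      show "sum h {n. n dvd M} \<le> K * real M powr c"
        using less.IH[OF \<open>M < N\<close> \<open>M > 0\<close>] by (simp add: K_def)
    qed (use hpos in \<open>auto intro: sum_nonneg\<close>)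
    also have "\<dots> = K * real N powr c" by (simp add: M powr_mult)
    finally show ?thesis by (simp add: K_def)
  qed
qed

section \<open>Chebyshev and Mertens estimates\<close>

text \<open>\<open>ln x \<le> x powr c\<close> holds for all positive \<open>x\<close> exactly when
  c is at least 1/e, and 3/8 lies just above 1/e. Later it matters that 1 - 3/8 exceeds 1/2.\<close>

lemma ln_le_powr_3_8:
  fixes x :: real
  assumes "x > 0"
  shows "ln x \<le> x powr (3/8)"
proof -
  \<comment> \<open>The goal is e >= 8/3. The quadratic Taylor bound at 1 gives only 5/2; at 1/3,
    after cubing, it is sharp enough.\<close>
  have "(1 + 1/3 + (1/3)\<^sup>2/2 :: real) ^ 3 \<le> exp (1/3) ^ 3"
    by (intro power_mono exp_lower_Taylor_quadratic) auto
  also have "exp (1/3) ^ 3 = exp (1::real)" by (simp flip: exp_of_nat_mult)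
  finally have e: "exp (1::real) \<ge> 8/3" by (simp add: power2_eq_square power3_eq_cube)
  define u where "u = x powr (3/8)"
  have u: "u > 0" using assms by (simp add: u_def)
  have "ln (u / exp 1) \<le> u / exp 1 - 1" using u by (intro ln_le_minus_one) auto
  hence "ln u \<le> u / exp 1" using u by (simp add: ln_div)
  also have "\<dots> \<le> u / (8/3)" using u e by (intro divide_left_mono) auto
  finally have "8/3 * ln u \<le> u" by simp
  thus ?thesis using assms by (simp add: u_def ln_powr)
qed

text \<open>Keeps every Euler factor \<open>1 - ln p / p\<close> at least 1/2, small primes
  included.\<close>

lemma ln_over_self_le_half:
  assumes "x > (0::real)"
  shows "ln x / x \<le> 1/2"
proof -
  have "ln (x/2) \<le> x/2 - 1" using assms by (intro ln_le_minus_one) auto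
  hence "ln x \<le> x/2 + (ln 2 - 1)" using assms by (simp add: ln_div)
  also have "\<dots> \<le> x/2" using ln_le_minus_one[of "2::real"] by simp
  finally show ?thesis using assms by (simp add: field_simps)
qed

lemma prime_ln_nonneg [simp]: "prime (p::nat) \<Longrightarrow> 0 \<le> ln (real p)"
  using prime_ge_1_nat[of p] by simp

lemma finite_primes_le [simp]: "finite {p::nat. prime p \<and> p \<le> n}"
  "finite {p::nat. prime p \<and> k < p \<and> p \<le> n}"
  by (rule finite_subset[of _ "{..n}"]; auto)+

section \<open>Chebyshev's upper bound by way of central binomial coefficients\<close>

lemma prod_primes_dvd:
  fixes n :: nat
  assumes "finite P" "\<And>p. p \<in> P \<Longrightarrow> prime p \<and> p dvd n"
  shows "\<Prod>P dvd n"
  using assms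
proof (induction P rule: finite_induct)
  case (insert p P)
  have "coprime p (\<Prod>P)"
    using insert by (intro prod_coprime_right) (metis insertCI primes_coprime)
  thus ?case using insert by (simp add: divides_mult)
qed auto

text \<open>Each of these primes divides (2k)! but not k!, hence the central binomial coefficient,
  which is at most 4^k.\<close>

lemma chebyshev_interval: 
  "(\<Sum>p | prime p \<and> k < p \<and> p \<le> 2 * k. ln (real p)) \<le> real k * ln 4"
proof -
  define P where "P = {p::nat. prime p \<and> k < p \<and> p \<le> 2 * k}"
  have "p dvd (2 * k choose k)" if "p \<in> P" for p
  proof -
    have p: "prime p" "k < p" "p \<le> 2 * k" using that by (auto simp: P_def)
    have "p dvd fact (2 * k)" using p by (simp add: prime_dvd_fact_iff)
    also have "fact (2 * k) = fact k * fact k * (2 * k choose k)"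
      using binomial_fact_lemma[of k "2*k"] by simp
    finally show ?thesis using p by (simp add: prime_dvd_mult_iff prime_dvd_fact_iff)
  qed
  hence "\<Prod>P dvd (2 * k choose k)"
    by (intro prod_primes_dvd) (auto simp: P_def)
  hence "\<Prod>P \<le> (2 * k choose k)" by (intro dvd_imp_le) auto
  also have "\<dots> \<le> 2 ^ (2 * k)" by (rule binomial_le_pow2)
  finally have "real (\<Prod>P) \<le> real (2 ^ (2 * k))" by (simp only: of_nat_le_iff)
  hence "ln (real (\<Prod>P)) \<le> ln (4 ^ k)"
    by (subst ln_le_cancel_iff) (auto simp: P_def power_mult intro!: prod_pos prime_gt_0_nat)
  also have "ln (real (\<Prod>P)) = (\<Sum>p\<in>P. ln (real p))"
    by (simp, subst ln_prod) (auto simp: P_def prime_gt_0_nat)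
  finally show ?thesis by (simp add: P_def ln_realpow)
qed

lemma chebyshev_upper: 
  "(\<Sum>p | prime p \<and> p \<le> n. ln (real p)) \<le> 3 * ln 4 * real n"
proof (induction n rule: less_induct)
  case (less n)
  show ?case
  proof (cases "n \<le> 1")
    case True
    hence "{p. prime p \<and> p \<le> n} = {}" by (auto dest!: prime_gt_1_nat)
    thus ?thesis by (simp only: sum.empty) simp
  next
    case False
    \<comment> \<open>Rounding up makes \<open>2 * k\<close> reach \<open>n\<close>. The constant 3
      pays for it: 3k + k = 4k <= 2n + 2 <= 3n for n >= 2.\<close>
    define k where "k = (n + 1) div 2"
    have k: "k < n" "n \<le> 2 * k" "2 * k \<le> n + 1" "k \<ge> 1" using False
      unfolding k_def by presburger+
    have "(\<Sum>p | prime p \<and> p \<le> n. ln (real p)) \<le>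
          (\<Sum>p\<in>{p. prime p \<and> p \<le> k} \<union> {p. prime p \<and> k < p \<and> p \<le> 2 * k}. ln (real p))"
      using k by (intro sum_mono2) (auto simp: prime_ge_1_nat Suc_leI)
    also have "\<dots> = (\<Sum>p | prime p \<and> p \<le> k. ln (real p)) + (\<Sum>p | prime p \<and> k < p \<and> p \<le> 2 * k. ln (real p))"
      by (intro sum.union_disjoint) auto
    also have "\<dots> \<le> 3 * ln 4 * real k + real k * ln 4"
      using less.IH[OF k(1)] chebyshev_interval[of k] by linarith
    also have "\<dots> = ln 4 * (4 * real k)" by simp
    also have "\<dots> \<le> ln 4 * (3 * real n)"
      using k False by (intro mult_left_mono) auto
    finally show ?thesis by simp
  qed
qed

text \<open>By Chebyshev the block from k to 2k contributes at most ln 4 / k, and these bounds form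
  a geometric series over dyadic blocks. A bound free of ln k is essential: in
  \<open>sum_small_weight\<close> it is multiplied by a \<open>y\<close> of size k and must stay
  bounded.\<close>

lemma sum_primes_ln_over_square_le:
  assumes "k > 0"
  shows "(\<Sum>p | prime p \<and> k < p \<and> p \<le> m. ln (real p) / (real p)\<^sup>2) \<le> 2 * ln 4 / real k"
  using assms
proof (induction "m - k" arbitrary: k rule: less_induct)
  case less
  let ?f = "\<lambda>p. ln (real p) / (real p)\<^sup>2"
  have step: "(\<Sum>p | prime p \<and> k < p \<and> p \<le> 2 * k. ?f p) \<le> ln 4 / real k"
  proof -
    have "(\<Sum>p | prime p \<and> k < p \<and> p \<le> 2 * k. ?f p) \<le> (\<Sum>p | prime p \<and> k < p \<and> p \<le> 2 * k. ln (real p) / (real k)\<^sup>2)"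
      using less.prems by (intro sum_mono divide_left_mono power_mono) auto
    also have "\<dots> = (\<Sum>p | prime p \<and> k < p \<and> p \<le> 2 * k. ln (real p)) / (real k)\<^sup>2"
      by (simp add: sum_divide_distrib)
    also have "\<dots> \<le> real k * ln 4 / (real k)\<^sup>2"
      by (intro divide_right_mono chebyshev_interval) auto
    finally show ?thesis using less.prems by (simp add: power2_eq_square)
  qed
  show ?case
  proof (cases "m \<le> 2 * k")
    case True
    have "(\<Sum>p | prime p \<and> k < p \<and> p \<le> m. ?f p) \<le> (\<Sum>p | prime p \<and> k < p \<and> p \<le> 2 * k. ?f p)"
      using True by (intro sum_mono2) auto
    also note step
    also have "ln 4 / real k \<le> 2 * ln 4 / real k" by (intro divide_right_mono) auto
    finally show ?thesis .
  next
    case False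
    have "(\<Sum>p | prime p \<and> k < p \<and> p \<le> m. ?f p) =
          (\<Sum>p\<in>{p. prime p \<and> k < p \<and> p \<le> 2 * k} \<union> {p. prime p \<and> 2 * k < p \<and> p \<le> m}. ?f p)"
      using False by (intro sum.cong) auto
    also have "\<dots> = (\<Sum>p | prime p \<and> k < p \<and> p \<le> 2 * k. ?f p) + (\<Sum>p | prime p \<and> 2 * k < p \<and> p \<le> m. ?f p)"
      by (intro sum.union_disjoint) auto
    also have "\<dots> \<le> ln 4 / real k + 2 * ln 4 / real (2 * k)"
      using False less.prems by (intro add_mono step less.hyps) auto
    finally show ?thesis by simp
  qed
qed

text \<open>The exponent of \<open>p\<close> in the factorial of \<open>n\<close>.\<close>

definition factorial_multiplicity :: "nat \<Rightarrow> nat \<Rightarrow> nat" where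
  "factorial_multiplicity p n = (\<Sum>j\<in>{1..n}. multiplicity p j)"

text \<open>Legendre's formula in recursive form: only the multiples \<open>p * j\<close>
  contribute, each with one factor \<open>p\<close> more than \<open>j\<close>.\<close>

lemma factorial_multiplicity_rec:
  assumes p: "prime p"
  shows "factorial_multiplicity p n = n div p + factorial_multiplicity p (n div p)"
proof -
  have p0: "p > 0" using p by (simp add: prime_gt_0_nat)
  have im: "(*) p ` {1..n div p} \<subseteq> {1..n}"
    using p0 by (auto simp: Suc_le_eq less_eq_div_iff_mult_less_eq mult.commute)
  have "factorial_multiplicity p n = (\<Sum>j\<in>(*) p ` {1..n div p}. multiplicity p j)"
    unfolding factorial_multiplicity_def
  proof (rule sum.mono_neutral_right)
    show "\<forall>i\<in>{1..n} - (*) p ` {1..n div p}. multiplicity p i = 0"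
    proof
      fix i assume i: "i \<in> {1..n} - (*) p ` {1..n div p}"
      have "\<not> p dvd i"
      proof
        assume "p dvd i"
        then obtain j where j: "i = p * j" by auto
        hence "j \<in> {1..n div p}" using i p0
          by (auto simp: less_eq_div_iff_mult_less_eq mult.commute Suc_le_eq)
        thus False using i j by auto
      qed
      thus "multiplicity p i = 0" by (rule not_dvd_imp_multiplicity_0)
    qed
  qed (use im in auto)
  also have "\<dots> = (\<Sum>j\<in>{1..n div p}. multiplicity p (p * j))"
    using p0 by (subst sum.reindex) (auto intro: inj_onI)
  also have "\<dots> = (\<Sum>j\<in>{1..n div p}. 1 + multiplicity p j)"
    using p by (intro sum.cong) (auto intro!: multiplicity_times_same[of _ p, simplified mult.commute[of _ p]] simp: prime_gt_0_nat)
  finally show ?thesis by (simp only: sum.distrib factorial_multiplicity_def) simp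
qed

lemma factorial_multiplicity_le:
  assumes p: "prime p"
  shows "(p - 1) * factorial_multiplicity p n \<le> n"
proof (induction n rule: less_induct)
  case (less n)
  show ?case
  proof (cases "n = 0")
    case False
    have "n div p < n" using False prime_gt_1_nat[OF p] by simp
    hence "(p - 1) * factorial_multiplicity p n \<le> (p - 1) * (n div p) + n div p"
      using less.IH by (subst factorial_multiplicity_rec[OF p]) (simp add: distrib_left)
    also have "\<dots> = p * (n div p)" using prime_gt_0_nat[OF p]
      by (cases p) auto
    also have "\<dots> \<le> n" by simp
    finally show ?thesis .
  qed (simp add: factorial_multiplicity_def)
qed

lemma ln_fact_eq_sum_primes:
  "ln (fact n) = (\<Sum>p | prime p \<and> p \<le> n. real (factorial_multiplicity p n) * ln (real p))"
proof -
  have "ln (fact n) = ln (\<Prod>j\<in>{1..n}. real j)" by (simp add: fact_prod)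
  also have "\<dots> = (\<Sum>j\<in>{1..n}. ln (real j))" by (subst ln_prod) auto
  also have "\<dots> = (\<Sum>j\<in>{1..n}. \<Sum>p | prime p \<and> p \<le> n. real (multiplicity p j) * ln (real p))"
  proof (intro sum.cong refl)
    fix j assume j: "j \<in> {1..n}"
    have "real j = real (\<Prod>p\<in>prime_factors j. p ^ multiplicity p j)"
      using j prime_factorization_nat[of j] by simp
    hence "ln (real j) = ln (\<Prod>p\<in>prime_factors j. real p ^ multiplicity p j)" by simp
    also have "\<dots> = (\<Sum>p\<in>prime_factors j. ln (real p ^ multiplicity p j))"
      by (subst ln_prod) (auto dest!: in_prime_factors_imp_prime prime_gt_0_nat)
    also have "\<dots> = (\<Sum>p\<in>prime_factors j. real (multiplicity p j) * ln (real p))"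
      by (simp add: ln_realpow)
    also have "\<dots> = (\<Sum>p | prime p \<and> p \<le> n. real (multiplicity p j) * ln (real p))"
    proof (rule sum.mono_neutral_left)
      show "prime_factors j \<subseteq> {p. prime p \<and> p \<le> n}"
        using j by (auto dest!: dvd_imp_le)
      show "\<forall>i\<in>{p. prime p \<and> p \<le> n} - prime_factors j. real (multiplicity i j) * ln (real i) = 0"
        using j by (auto simp: prime_factors_multiplicity)
    qed simp
    finally show "ln (real j) = \<dots>" .
  qed
  also have "\<dots> = (\<Sum>p | prime p \<and> p \<le> n. \<Sum>j\<in>{1..n}. real (multiplicity p j) * ln (real p))"
    by (rule sum.swap)
  finally show ?thesis by (simp add: factorial_multiplicity_def sum_distrib_right)
qed

text \<open>Compares \<open>ln (fact n) \<le> n * ln n\<close> with its expansion over primes. The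
  exponent of \<open>p\<close> is at least n/p - 1, and the total loss from the -1 is O(n) by
  Chebyshev.\<close>

lemma mertens_upper:
  assumes "n > 0"
  shows "(\<Sum>p | prime p \<and> p \<le> n. ln (real p) / real p) \<le> ln (real n) + 3 * ln 4"
proof -
  let ?P = "{p. prime p \<and> p \<le> n}"
  have "real n * (\<Sum>p\<in>?P. ln (real p) / real p) - (\<Sum>p\<in>?P. ln (real p)) =
        (\<Sum>p\<in>?P. (real n / real p - 1) * ln (real p))"
    by (simp add: sum_distrib_left sum_subtractf algebra_simps)
  also have "\<dots> \<le> (\<Sum>p\<in>?P. real (factorial_multiplicity p n) * ln (real p))"
  proof (intro sum_mono mult_right_mono)
    fix p assume p: "p \<in> ?P"
    have "real n = real (n div p) * real p + real (n mod p)"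
      by (simp flip: of_nat_mult of_nat_add)
    moreover have "n mod p < p" using p by (auto simp: prime_gt_0_nat)
    ultimately have "real n / real p - 1 \<le> real (n div p)" using p
      by (simp add: field_simps)
    also have "\<dots> \<le> real (factorial_multiplicity p n)"
      using p by (subst factorial_multiplicity_rec) auto
    finally show "real n / real p - 1 \<le> real (factorial_multiplicity p n)" .
    show "0 \<le> ln (real p)" using p prime_ge_1_nat[of p] by auto
  qed
  also have "\<dots> = ln (fact n)" by (simp add: ln_fact_eq_sum_primes)
  also have "\<dots> \<le> ln (real (n ^ n))" using fact_le_power[of n, where 'a=real] assms
    by (subst ln_le_cancel_iff) auto
  also have "\<dots> = real n * ln (real n)" using assms by (simp add: ln_realpow)
  finally have "real n * (\<Sum>p\<in>?P. ln (real p) / real p) \<le> real n * ln (real n) + (\<Sum>p\<in>?P. ln (real p))"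
    by simp
  also have "\<dots> \<le> real n * (ln (real n) + 3 * ln 4)"
    using chebyshev_upper[of n] by (simp add: algebra_simps)
  finally show ?thesis using assms by simp
qed

lemma ln_fact_ge:
  "real n * ln (real n) - real n \<le> ln (fact n)"
proof (induction n)
  case (Suc n)
  show ?case
  proof (cases "n = 0")
    case False
    have "real n * ln (1 + 1 / real n) \<le> real n * (1 / real n)"
      by (intro mult_left_mono ln_add_one_self_le_self) auto
    hence "real n * (ln (real (Suc n)) - ln (real n)) \<le> 1"
      using False by (simp flip: ln_divide_pos add: field_simps)
    moreover have "ln (fact (Suc n)) = ln (real (Suc n)) + ln (fact n :: real)"
      by (simp only: fact_Suc of_nat_mult, subst ln_mult) auto
    ultimately show ?thesis using Suc.IH by (simp add: algebra_simps)
  qed simp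
qed simp

text \<open>The reverse comparison: now \<open>ln (fact n)\<close> is bounded below, and the
  exponent of \<open>p\<close> is at most n/(p-1).\<close>

lemma mertens_lower:
  assumes "n > 0"
  shows "ln (real n) - 1 - 4 * ln 4 \<le> (\<Sum>p | prime p \<and> p \<le> n. ln (real p) / real p)"
proof -
  let ?P = "{p. prime p \<and> p \<le> n}"
  have "real n * ln (real n) - real n \<le> ln (fact n)" by (rule ln_fact_ge)
  also have "\<dots> = (\<Sum>p\<in>?P. real (factorial_multiplicity p n) * ln (real p))" by (rule ln_fact_eq_sum_primes)
  also have "\<dots> \<le> (\<Sum>p\<in>?P. real n * (ln (real p) / real p + 2 * (ln (real p) / (real p)\<^sup>2)))"
  proof (intro sum_mono)
    fix p assume p: "p \<in> ?P"
    have p2: "real p \<ge> 2" using p prime_ge_2_nat[of p] by auto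
    have "real ((p - 1) * factorial_multiplicity p n) \<le> real n"
      using p factorial_multiplicity_le by (simp only: of_nat_le_iff) auto
    hence "real (factorial_multiplicity p n) \<le> real n / (real p - 1)"
      using p2 by (simp add: of_nat_diff field_simps)
    \<comment> \<open>The difference 1/(p-1) - 1/p = 1/(p(p-1)) is at most 2/p^2 because p >= 2; the
      sum over the squares then costs only the constant 4 ln 4.\<close>
    also have "1 / (real p - 1) \<le> 1 / real p + 2 / (real p)\<^sup>2"
      using p2 by (simp add: field_simps power2_eq_square)
    hence "real n / (real p - 1) \<le> real n * (1 / real p + 2 / (real p)\<^sup>2)"
      by (metis mult_left_mono of_nat_0_le_iff times_divide_eq_right mult.right_neutral)
    finally have "real (factorial_multiplicity p n) * ln (real p) \<le> real n * (1 / real p + 2 / (real p)\<^sup>2) * ln (real p)"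
      using p2 by (intro mult_right_mono) auto
    thus "real (factorial_multiplicity p n) * ln (real p) \<le> real n * (ln (real p) / real p + 2 * (ln (real p) / (real p)\<^sup>2))"
      by (simp add: algebra_simps)
  qed
  also have "\<dots> = real n * ((\<Sum>p\<in>?P. ln (real p) / real p) + 2 * (\<Sum>p\<in>?P. ln (real p) / (real p)\<^sup>2))"
    by (simp add: sum_distrib_left sum.distrib algebra_simps)
  finally have "real n * (ln (real n) - 1) \<le> \<dots>" by (simp add: algebra_simps)
  hence "ln (real n) - 1 \<le> (\<Sum>p\<in>?P. ln (real p) / real p) + 2 * (\<Sum>p\<in>?P. ln (real p) / (real p)\<^sup>2)"
    using assms by simp
  also have "?P = {p. prime p \<and> 1 < p \<and> p \<le> n}" by (auto dest: prime_gt_1_nat)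
  hence "(\<Sum>p\<in>?P. ln (real p) / (real p)\<^sup>2) \<le> 2 * ln 4"
    using sum_primes_ln_over_square_le[of 1 n] by simp
  finally show ?thesis by simp
qed

text \<open>Controls the second-order terms in logarithms of Euler products. The exponent is 2 * 3/8
  - 2 = -5/4.\<close>

lemma sum_primes_ln_over_squared_bounded:
  obtains B where "\<And>P. finite P \<Longrightarrow> (\<And>p. p \<in> P \<Longrightarrow> p > 0) \<Longrightarrow> (\<Sum>p\<in>P. (ln (real p) / real p)\<^sup>2) \<le> B"
proof
  have s: "summable (\<lambda>n. real n powr (-5/4))" by (simp add: summable_real_powr_iff)
  fix P :: "nat set" assume P: "finite P" "\<And>p. p \<in> P \<Longrightarrow> p > 0"
  have "(\<Sum>p\<in>P. (ln (real p) / real p)\<^sup>2) \<le> (\<Sum>p\<in>P. real p powr (-5/4))"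
  proof (intro sum_mono)
    fix p assume "p \<in> P"
    hence p: "p > 0" using P by auto
    have "(ln (real p))\<^sup>2 \<le> (real p powr (3/8))\<^sup>2"
      using p by (intro power_mono ln_le_powr_3_8) auto
    also have "\<dots> = real p powr (3/4)" by (simp add: power2_eq_square flip: powr_add)
    finally have "(ln (real p) / real p)\<^sup>2 \<le> real p powr (3/4) / (real p)\<^sup>2"
      by (simp add: power_divide divide_right_mono)
    also have "\<dots> = real p powr (3/4 - 2)" using p by (simp only: powr_diff) simp
    finally show "(ln (real p) / real p)\<^sup>2 \<le> real p powr (-5/4)" by simp
  qed
  also have "\<dots> \<le> (\<Sum>n. real n powr (-5/4))"
    using s P by (intro sum_le_suminf) auto
  finally show "(\<Sum>p\<in>P. (ln (real p) / real p)\<^sup>2) \<le> (\<Sum>n. real n powr (-5/4))" .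
qed

section \<open>Boundedness of the coefficient operator for \<open>\<lambda> \<le> 1\<close>\<close>

text \<open>The logarithm of an Euler factor is h + O(h^2), and the squares have a bounded sum. The
  constant is uniform in \<open>h\<close>, which matters since the weights vary with
  \<open>y\<close>.\<close>

lemma euler_product_le_exp_sum:
  obtains C where "C > 0" "\<And>P h. finite P \<Longrightarrow> (\<And>p. p \<in> P \<Longrightarrow> prime p \<and> 0 \<le> h p \<and> h p \<le> ln (real p) / real p) \<Longrightarrow>
      (\<Prod>p\<in>P. 1 / (1 - h p)) \<le> C * exp (\<Sum>p\<in>P. h p)"
proof -
  obtain B where B: "\<And>P. finite P \<Longrightarrow> (\<And>p. p \<in> P \<Longrightarrow> p > 0) \<Longrightarrow> (\<Sum>p\<in>P. (ln (real p) / real p)\<^sup>2) \<le> B"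
    using sum_primes_ln_over_squared_bounded by blast
  show ?thesis
  proof (rule that[of "exp (2 * B)"])
    fix P :: "nat set" and h :: "nat \<Rightarrow> real"
    assume P: "finite P" and h: "\<And>p. p \<in> P \<Longrightarrow> prime p \<and> 0 \<le> h p \<and> h p \<le> ln (real p) / real p"
    have "(\<Prod>p\<in>P. 1 / (1 - h p)) \<le> (\<Prod>p\<in>P. exp (h p + 2 * (ln (real p) / real p)\<^sup>2))"
    proof (intro prod_mono conjI)
      fix p assume p: "p \<in> P"
      have hp: "0 \<le> h p" "h p \<le> 1/2" "prime p"
        using h[OF p] order_trans[of "h p" _ "1/2", OF _ ln_over_self_le_half[of "real p"]]
        by (auto simp: prime_gt_0_nat)
      have "- h p - 2 * (h p)\<^sup>2 \<le> ln (1 - h p)"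
        using hp by (intro ln_one_minus_pos_lower_bound) auto
      moreover have "(h p)\<^sup>2 \<le> (ln (real p) / real p)\<^sup>2"
        using h[OF p] by (intro power_mono) auto
      ultimately have "- ln (1 - h p) \<le> h p + 2 * (ln (real p) / real p)\<^sup>2" by linarith
      hence "exp (- ln (1 - h p)) \<le> exp (h p + 2 * (ln (real p) / real p)\<^sup>2)" by simp
      thus "1 / (1 - h p) \<le> exp (h p + 2 * (ln (real p) / real p)\<^sup>2)"
        using hp by (simp add: exp_minus field_simps)
      show "0 \<le> 1 / (1 - h p)" using hp by simp
    qed
    also have "\<dots> = exp (\<Sum>p\<in>P. h p) * exp (2 * (\<Sum>p\<in>P. (ln (real p) / real p)\<^sup>2))"
      using P by (simp add: exp_sum prod.distrib sum_distrib_left exp_add)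
    also have "\<dots> \<le> exp (\<Sum>p\<in>P. h p) * exp (2 * B)"
      using B[OF P] h by (intro mult_left_mono) (auto simp: prime_gt_0_nat)
    finally show "(\<Prod>p\<in>P. 1 / (1 - h p)) \<le> exp (2 * B) * exp (\<Sum>p\<in>P. h p)"
      by (simp add: mult.commute)
  qed auto
qed

text \<open>The maximum covers \<open>y < 1\<close>, which occurs for
  \<open>y = ln 2\<close>.\<close>

lemma mertens_upper_real:
  assumes "y > (0::real)"
  shows "(\<Sum>p | prime p \<and> real p \<le> y. ln (real p) / real p) \<le> ln (max 1 y) + 3 * ln 4"
proof (cases "y \<ge> 1")
  case True
  have eq: "real p \<le> y \<longleftrightarrow> p \<le> nat \<lfloor>y\<rfloor>" for p :: nat using assms by linarith
  have "nat \<lfloor>y\<rfloor> > 0" using True by linarith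
  hence "(\<Sum>p | prime p \<and> real p \<le> y. ln (real p) / real p) \<le> ln (real (nat \<lfloor>y\<rfloor>)) + 3 * ln 4"
    unfolding eq by (rule mertens_upper)
  also have "ln (real (nat \<lfloor>y\<rfloor>)) \<le> ln y"
    using True \<open>nat \<lfloor>y\<rfloor> > 0\<close> by (subst ln_le_cancel_iff) auto
  finally show ?thesis using True by simp
next
  case False
  have "\<not> (prime p \<and> real p \<le> y)" for p :: nat using False prime_ge_1_nat[of p] by auto
  hence "{p::nat. prime p \<and> real p \<le> y} = {}" by blast
  thus ?thesis using False by (simp only: sum.empty) simp
qed

text \<open>Weights for Cauchy--Schwarz with \<open>y\<close> of size \<open>log N\<close>: their product is \<open>(log p / p)\<^sup>2\<close>. Beyond \<open>y\<close>,
  the large weight still costs only a bounded factor, as \<open>\<Sum> log p \<le> log N\<close> over the primes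
  dividing \<open>N\<close>, while the small weight becomes summable over the primes.\<close>

definition large_weight :: "real \<Rightarrow> nat \<Rightarrow> real" where
  "large_weight y p = (if real p \<le> y then ln (real p) / real p else ln (real p) / y)"

definition small_weight :: "real \<Rightarrow> nat \<Rightarrow> real" where
  "small_weight y p = (if real p \<le> y then ln (real p) / real p else y * ln (real p) / (real p)\<^sup>2)"

lemma finite_primes_le_real [simp]: "finite {p::nat. prime p \<and> real p \<le> y}"
  by (rule finite_subset[of _ "{..nat \<lceil>y\<rceil>}"]) (auto, linarith)

text \<open>With \<open>y = ln N\<close> and c = 1/y, the primes beyond \<open>y\<close> cost
  N^(1/y) = e altogether, and by Mertens those up to \<open>y\<close> cost exp(ln y + O(1)) =
  O(y).\<close>

lemma sum_divisors_large_weight: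
  obtains C where "C > 0" 
    "\<And>N. N \<ge> 2 \<Longrightarrow> (\<Sum>n | n dvd N. mult_ext (large_weight (ln (real N))) n) \<le> C * ln (real N)"
proof -
  obtain C where C: "C > 0" "\<And>P h. finite P \<Longrightarrow> (\<And>p. p \<in> P \<Longrightarrow> prime p \<and> 0 \<le> h p \<and> h p \<le> ln (real p) / real p) \<Longrightarrow>
      (\<Prod>p\<in>P. 1 / (1 - h p)) \<le> C * exp (\<Sum>p\<in>P. h p)"
    using euler_product_le_exp_sum by blast
  show ?thesis
  proof (rule that[of "C * exp (3 * ln 4) / ln 2 * exp 1"])
    fix N :: nat assume N: "N \<ge> 2"
    define y where "y = ln (real N)"
    have y: "y \<ge> ln 2" "y > 0" using N by (auto simp: y_def)
    define P where "P = {p::nat. prime p \<and> real p \<le> y}"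
    let ?h = "mult_ext (large_weight y)"
    have "(\<Sum>n | n dvd N. ?h n) \<le> (\<Prod>p\<in>P. 1 / (1 - ?h p)) * real N powr (1 / y)"
    proof (rule sum_divisors_le_euler_product)
      show "finite P" unfolding P_def by simp
      show "0 \<le> ?h p" if "prime p" for p
        using that y prime_ge_1_nat[OF that] by (auto simp: large_weight_def)
      show "prime p \<and> ?h p < 1" if "p \<in> P" for p
        using that ln_over_self_le_half[of "real p"]
        by (auto simp: P_def large_weight_def prime_gt_0_nat intro: le_less_trans)
      show "?h p \<le> 1 / y * ln (real p)" if "prime p" "p \<notin> P" for p
        using that by (auto simp: P_def large_weight_def)
    qed (use y N completely_multiplicative_mult_ext in auto)
    also have "real N powr (1 / y) = exp 1" using N y by (simp add: powr_def y_def)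
    also have "(\<Prod>p\<in>P. 1 / (1 - ?h p)) \<le> C * exp (\<Sum>p\<in>P. ?h p)"
      by (intro C(2)) (auto simp: P_def large_weight_def)
    also have "(\<Sum>p\<in>P. ?h p) = (\<Sum>p\<in>P. ln (real p) / real p)"
      by (intro sum.cong) (auto simp: P_def large_weight_def)
    also have "\<dots> \<le> ln (max 1 y) + 3 * ln 4"
      unfolding P_def by (rule mertens_upper_real) (use y in auto)
    also have "exp (ln (max 1 y) + 3 * ln 4) = max 1 y * exp (3 * ln 4)"
      by (simp add: exp_add)
    \<comment> \<open>For N = 2 the value of \<open>y\<close> is below 1; it is never below
      \<open>ln 2\<close>.\<close>
    also have "max 1 y \<le> y / ln 2"
      using y ln_le_minus_one[of "2::real"] mult_left_mono[of "ln 2" 1 y] by (auto simp: field_simps)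
    finally show "(\<Sum>n | n dvd N. mult_ext (large_weight (ln (real N))) n) \<le> C * exp (3 * ln 4) / ln 2 * exp 1 * ln (real N)"
      using C(1) by (simp add: y_def field_simps)
  qed (use C in auto)
qed

text \<open>Mertens bounds the exponent by ln y + O(1) for the primes up to \<open>y\<close>; beyond
  \<open>y\<close> the tail is \<open>y\<close> times O(1/y). The factor 2 in the parameter is there
  because log N can be as large as 2 log m when \<open>n \<le> m\<close>.\<close>

lemma sum_small_weight:
  obtains C where "C > 0"
    "\<And>m. m \<ge> 2 \<Longrightarrow> (\<Sum>n\<in>{1..m}. mult_ext (small_weight (2 * ln (real m))) n) \<le> C * ln (real m)"
proof -
  obtain C where C: "C > 0" "\<And>P h. finite P \<Longrightarrow> (\<And>p. p \<in> P \<Longrightarrow> prime p \<and> 0 \<le> h p \<and> h p \<le> ln (real p) / real p) \<Longrightarrow>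
      (\<Prod>p\<in>P. 1 / (1 - h p)) \<le> C * exp (\<Sum>p\<in>P. h p)"
    using euler_product_le_exp_sum by blast
  show ?thesis
  proof (rule that[of "C * exp (3 * ln 4 + 4 * ln 4) * 2"])
    fix m :: nat assume m: "m \<ge> 2"
    define y where "y = 2 * ln (real m)"
    \<comment> \<open>Leads to \<open>y \<ge> 1\<close> already for m = 2, so that the integer part
      \<open>k\<close> of \<open>y\<close> is positive and at least y/2.\<close>
    have "exp (1/2 :: real) ^ 2 = exp 1" by (simp flip: exp_of_nat_mult)
    hence "exp (1/2 :: real) \<le> 2" using exp_le
      by (intro power2_le_imp_le[of "exp (1/2)" 2]) auto
    hence "1/2 \<le> ln (2::real)" by (subst ln_ge_iff) auto
    also have "\<dots> \<le> ln (real m)" using m by simp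
    finally have y: "y \<ge> 1" by (simp add: y_def)
    define P where "P = {p::nat. prime p \<and> p \<le> m}"
    define k where "k = nat \<lfloor>y\<rfloor>"
    have k: "k > 0" "real k \<le> y" "y \<le> 2 * real k" "\<And>p::nat. real p \<le> y \<longleftrightarrow> p \<le> k"
    proof -
      have fl: "real (nat \<lfloor>y\<rfloor>) = of_int \<lfloor>y\<rfloor>" "\<lfloor>y\<rfloor> \<ge> 1" using y by auto
      show "k > 0" "real k \<le> y" using fl unfolding k_def by linarith+
      show "y \<le> 2 * real k" unfolding k_def fl(1) using fl(2) y by linarith
      show "real p \<le> y \<longleftrightarrow> p \<le> k" for p :: nat unfolding k_def using y by linarith
    qed
    let ?h = "mult_ext (small_weight y)"
    have hle: "small_weight y p \<le> ln (real p) / real p" "0 \<le> small_weight y p" if "prime p" for p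
    proof -
      have p: "real p \<ge> 1" using prime_ge_1_nat[OF that] by simp
      show "0 \<le> small_weight y p" using p y by (auto simp: small_weight_def)
      have "y * ln (real p) / (real p)\<^sup>2 \<le> real p * ln (real p) / (real p)\<^sup>2" if "y < real p"
        using that p by (intro divide_right_mono mult_right_mono) auto
      thus "small_weight y p \<le> ln (real p) / real p"
        using p by (auto simp: small_weight_def power2_eq_square)
    qed
    have "(\<Sum>n\<in>{1..m}. ?h n) \<le> (\<Sum>n | 0 < n \<and> n \<le> m \<and> prime_factors n \<subseteq> P. ?h n)"
    proof (rule eq_refl, rule sum.cong)
      show "{1..m} = {n. 0 < n \<and> n \<le> m \<and> prime_factors n \<subseteq> P}"
        by (auto simp: P_def prime_factors_dvd dest!: dvd_imp_le)
    qed auto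
    also have "\<dots> \<le> (\<Prod>p\<in>P. 1 / (1 - ?h p))"
    proof (rule sum_smooth_le_euler_product)
      show "prime p \<and> ?h p < 1" if "p \<in> P" for p
        using that ln_over_self_le_half[of "real p"] hle[of p]
        by (auto simp: P_def prime_gt_0_nat intro: le_less_trans)
    qed (use hle in \<open>auto simp: P_def completely_multiplicative_mult_ext\<close>)
    also have "\<dots> \<le> C * exp (\<Sum>p\<in>P. ?h p)"
      using hle by (intro C(2)) (auto simp: P_def)
    also have "(\<Sum>p\<in>P. ?h p) \<le> (\<Sum>p\<in>{p. prime p \<and> real p \<le> y} \<union> {p. prime p \<and> k < p \<and> p \<le> m}. ?h p)"
      using hle k by (intro sum_mono2) (auto simp: P_def)
    also have "\<dots> = (\<Sum>p | prime p \<and> real p \<le> y. ?h p) + (\<Sum>p | prime p \<and> k < p \<and> p \<le> m. ?h p)"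
      using k by (intro sum.union_disjoint) auto
    also have "(\<Sum>p | prime p \<and> real p \<le> y. ?h p) = (\<Sum>p | prime p \<and> real p \<le> y. ln (real p) / real p)"
      by (intro sum.cong) (auto simp: small_weight_def)
    also have "\<dots> \<le> ln y + 3 * ln 4" using mertens_upper_real[of y] y by simp
    also have "(\<Sum>p | prime p \<and> k < p \<and> p \<le> m. ?h p) = (\<Sum>p | prime p \<and> k < p \<and> p \<le> m. y * (ln (real p) / (real p)\<^sup>2))"
      using k by (intro sum.cong) (auto simp: small_weight_def)
    also have "\<dots> \<le> y * (2 * ln 4 / real k)"
      unfolding sum_distrib_left[symmetric] using \<open>y \<ge> 1\<close> \<open>k > 0\<close>
      by (intro mult_left_mono sum_primes_ln_over_square_le) auto
    also have "\<dots> \<le> 4 * ln 4" using k by (simp add: field_simps)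
    finally have "(\<Sum>n\<in>{1..m}. ?h n) \<le> C * exp (ln y + 3 * ln 4 + 4 * ln 4)"
      using C(1) by simp
    also have "exp (ln y + 3 * ln 4 + 4 * ln 4) = y * exp (3 * ln 4 + 4 * ln 4)"
      using y by (subst add.assoc, subst exp_add) simp
    finally show "(\<Sum>n\<in>{1..m}. mult_ext (small_weight (2 * ln (real m))) n) \<le> C * exp (3 * ln 4 + 4 * ln 4) * 2 * ln (real m)"
      by (simp add: y_def mult_ac)
  qed (use C in auto)
qed

text \<open>Exchange of summation by (N, n) -> (N/n, n), which is injective because \<open>n\<close>
  divides \<open>N\<close>; the image is then enlarged, using nonnegativity.\<close>

lemma sum_divisor_pairs_le:
  fixes G :: "nat \<Rightarrow> nat \<Rightarrow> real"
  assumes "finite A" "\<And>N. N \<in> A \<Longrightarrow> N > 0" "\<And>N n. N \<in> A \<Longrightarrow> n \<in> D N \<Longrightarrow> n dvd N"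
    and "finite B" "\<And>m. m \<in> B \<Longrightarrow> finite (E m)"
    and "\<And>N n. N \<in> A \<Longrightarrow> n \<in> D N \<Longrightarrow> N div n \<in> B \<and> n \<in> E (N div n)"
    and "\<And>m n. m \<in> B \<Longrightarrow> n \<in> E m \<Longrightarrow> G m n \<ge> 0"
  shows "(\<Sum>N\<in>A. \<Sum>n\<in>D N. G (N div n) n) \<le> (\<Sum>m\<in>B. \<Sum>n\<in>E m. G m n)"
proof -
  have fin: "finite (D N)" if "N \<in> A" for N
    using assms(2,3)[OF that] by (intro finite_subset[of "D N" "{n. n dvd N}"]) auto
  have inj: "inj_on (\<lambda>(N, n). (N div n, n)) (Sigma A D)"
  proof (rule inj_onI, clarify)
    fix N n M assume "N \<in> A" "n \<in> D N" "M \<in> A" "n \<in> D M" "N div n = M div n"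
    thus "N = M \<and> n = n" using assms(3) by (metis dvd_div_mult_self)
  qed
  have "(\<Sum>N\<in>A. \<Sum>n\<in>D N. G (N div n) n) = (\<Sum>(N, n)\<in>Sigma A D. G (N div n) n)"
    using assms(1) fin by (subst sum.Sigma) auto
  also have "\<dots> = (\<Sum>(m, n)\<in>(\<lambda>(N, n). (N div n, n)) ` Sigma A D. G m n)"
    by (subst sum.reindex[OF inj]) (auto intro!: sum.cong)
  also have "\<dots> \<le> (\<Sum>(m, n)\<in>Sigma B E. G m n)"
    using assms(4-7) by (intro sum_mono2) auto
  also have "\<dots> = (\<Sum>m\<in>B. \<Sum>n\<in>E m. G m n)"
    using assms(4,5) by (subst sum.Sigma) auto
  finally show ?thesis .
qed

text \<open>The function \<open>\<psi>\<close> for lambda = 1. Boundedness is proved for it alone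
  and passes to smaller lambda by monotonicity.\<close>

abbreviation psi1 :: "nat \<Rightarrow> real" where
  "psi1 \<equiv> mult_ext (\<lambda>p. ln (real p) / real p)"

section \<open>Sign and monotonicity of the weights\<close>

lemma mult_ext_nonneg: "(\<And>p. prime p \<Longrightarrow> f p \<ge> 0) \<Longrightarrow> n > 0 \<Longrightarrow> mult_ext f n \<ge> 0"
  by (rule completely_multiplicative_nonneg[OF completely_multiplicative_mult_ext]) auto

lemma mult_ext_mono:
  assumes "\<And>p. prime p \<Longrightarrow> f p \<ge> 0" "\<And>p. prime p \<Longrightarrow> f p \<le> g p" "n > 0"
  shows "mult_ext f n \<le> mult_ext g n"
  by (rule completely_multiplicative_mono[OF completely_multiplicative_mult_ext completely_multiplicative_mult_ext])
     (use assms in auto)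

lemma small_weight_nonneg: "prime p \<Longrightarrow> y > 0 \<Longrightarrow> small_weight y p \<ge> 0"
  using prime_ge_1_nat[of p] by (auto simp: small_weight_def)

lemma large_weight_nonneg: "prime p \<Longrightarrow> y > 0 \<Longrightarrow> large_weight y p \<ge> 0"
  using prime_ge_1_nat[of p] by (auto simp: large_weight_def)

text \<open>The weight equals (ln p / p) * min(1, y/p), which increases with
  \<open>y\<close>.\<close>

lemma small_weight_mono:
  assumes "prime p" "0 < y" "y \<le> z"
  shows "small_weight y p \<le> small_weight z p"
proof -
  have p: "real p \<ge> 1" "ln (real p) \<ge> 0" using prime_ge_1_nat[OF assms(1)] by auto
  have "y * ln (real p) / (real p)\<^sup>2 \<le> w * ln (real p) / (real p)\<^sup>2" if "y \<le> w" for w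
    using that p by (intro divide_right_mono mult_right_mono) auto
  from this[of "real p"] this[of z] show ?thesis
    using assms by (auto simp: small_weight_def power2_eq_square)
qed

text \<open>In the Cauchy-Schwarz inequality the large weights sum to O(log N), which leaves one
  factor 1 / log N after division by (log N)^2. Once log N is replaced by log m, the exchanged sum
  of small weights is O(log m) and cancels that factor.\<close>

lemma bound_small_divisors:
  obtains C where "C > 0"
    "\<And>\<alpha> X. (\<And>n. \<alpha> n \<ge> 0) \<Longrightarrow> (\<Sum>N\<in>{2..X}. ((\<Sum>n | n dvd N \<and> 2 \<le> n \<and> n \<le> N div n. \<alpha> (N div n) * psi1 n) / ln (real N))\<^sup>2)
        \<le> C * (\<Sum>m\<in>{1..X}. (\<alpha> m)\<^sup>2)"
proof -
  obtain C1 where C1: "C1 > 0"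
    "\<And>N. N \<ge> 2 \<Longrightarrow> (\<Sum>n | n dvd N. mult_ext (large_weight (ln (real N))) n) \<le> C1 * ln (real N)"
    using sum_divisors_large_weight by blast
  obtain C2 where C2: "C2 > 0"
    "\<And>m. m \<ge> 2 \<Longrightarrow> (\<Sum>n\<in>{1..m}. mult_ext (small_weight (2 * ln (real m))) n) \<le> C2 * ln (real m)"
    using sum_small_weight by blast
  show ?thesis
  proof (rule that[of "C1 * C2"])
    fix \<alpha> :: "nat \<Rightarrow> real" and X :: nat assume nn: "\<And>n. \<alpha> n \<ge> 0"
    define D where "D = (\<lambda>N::nat. {n. n dvd N \<and> 2 \<le> n \<and> n \<le> N div n})"
    \<comment> \<open>The summand with log N replaced by quantities depending on \<open>m\<close>
      only, each chosen so that the term can only grow: log m in the denominator, 2 log m in the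
      weight.\<close>
    define G where "G = (\<lambda>m n. (\<alpha> m)\<^sup>2 / ln (real m) * mult_ext (small_weight (2 * ln (real m))) n)"
    have *: "((\<Sum>n\<in>D N. \<alpha> (N div n) * psi1 n) / ln (real N))\<^sup>2 \<le> C1 * (\<Sum>n\<in>D N. G (N div n) n)"
      if N: "N \<ge> 2" for N
    proof -
      let ?y = "ln (real N)"
      have y: "?y > 0" using N by simp
      have fin: "finite (D N)" using N by (intro finite_subset[of "D N" "{n. n dvd N}"]) (auto simp: D_def)
      have snn: "mult_ext (small_weight ?y) n \<ge> 0" and lnn: "mult_ext (large_weight ?y) n \<ge> 0" if "n > 0" for n
        using that y by (auto intro!: mult_ext_nonneg small_weight_nonneg large_weight_nonneg)
      have prod: "psi1 n = sqrt (mult_ext (small_weight ?y) n) * sqrt (mult_ext (large_weight ?y) n)" if "n > 0" for n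
      proof -
        have "psi1 n \<ge> 0" using that by (intro mult_ext_nonneg) auto
        moreover have "(\<lambda>p. small_weight ?y p * large_weight ?y p) =
              (\<lambda>p. (ln (real p) / real p) * (ln (real p) / real p))"
          using y by (auto simp: small_weight_def large_weight_def fun_eq_iff power2_eq_square)
        hence "mult_ext (small_weight ?y) n * mult_ext (large_weight ?y) n = (psi1 n)\<^sup>2"
          by (simp add: mult_ext_times power2_eq_square)
        ultimately show ?thesis by (metis abs_of_nonneg real_sqrt_abs real_sqrt_mult)
      qed
      have "(\<Sum>n\<in>D N. \<alpha> (N div n) * psi1 n)\<^sup>2 =
            (\<Sum>n\<in>D N. (\<alpha> (N div n) * sqrt (mult_ext (small_weight ?y) n)) * sqrt (mult_ext (large_weight ?y) n))\<^sup>2"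
        by (intro arg_cong[where f = "\<lambda>x. x\<^sup>2"] sum.cong refl) (auto simp: D_def prod)
      also have "\<dots> \<le> (\<Sum>n\<in>D N. (\<alpha> (N div n) * sqrt (mult_ext (small_weight ?y) n))\<^sup>2) *
                       (\<Sum>n\<in>D N. (sqrt (mult_ext (large_weight ?y) n))\<^sup>2)"
        by (rule Cauchy_Schwarz_ineq_sum)
      also have "\<dots> = (\<Sum>n\<in>D N. (\<alpha> (N div n))\<^sup>2 * mult_ext (small_weight ?y) n) * (\<Sum>n\<in>D N. mult_ext (large_weight ?y) n)"
        by (intro arg_cong2[where f = "(*)"] sum.cong refl) (auto simp: D_def power_mult_distrib snn lnn)
      also have "\<dots> \<le> (\<Sum>n\<in>D N. (\<alpha> (N div n))\<^sup>2 * mult_ext (small_weight ?y) n) * (C1 * ?y)"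
      proof (rule mult_left_mono)
        have "(\<Sum>n\<in>D N. mult_ext (large_weight ?y) n) \<le> (\<Sum>n | n dvd N. mult_ext (large_weight ?y) n)"
          using N by (intro sum_mono2) (auto simp: D_def intro!: lnn Nat.gr0I)
        also have "\<dots> \<le> C1 * ?y" by (rule C1(2)[OF N])
        finally show "(\<Sum>n\<in>D N. mult_ext (large_weight ?y) n) \<le> C1 * ?y" .
      qed (auto intro!: sum_nonneg mult_nonneg_nonneg snn simp: D_def)
      finally have "((\<Sum>n\<in>D N. \<alpha> (N div n) * psi1 n) / ?y)\<^sup>2 \<le>
                      (\<Sum>n\<in>D N. (\<alpha> (N div n))\<^sup>2 * mult_ext (small_weight ?y) n) * (C1 * ?y) / ?y\<^sup>2"
        by (simp add: power_divide divide_right_mono)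
      also have "\<dots> = C1 * (\<Sum>n\<in>D N. (\<alpha> (N div n))\<^sup>2 / ?y * mult_ext (small_weight ?y) n)"
        using y by (simp add: sum_distrib_left sum_distrib_right sum_divide_distrib field_simps power2_eq_square)
      also have "\<dots> \<le> C1 * (\<Sum>n\<in>D N. G (N div n) n)"
      proof (intro mult_left_mono sum_mono)
        fix n assume n: "n \<in> D N"
        define m where "m = N div n"
        have m: "N = m * n" "2 \<le> n" "n \<le> m" using n by (auto simp: D_def m_def)
        have "N \<le> m * m" using m by simp
        hence "real N \<le> real m * real m" by (metis of_nat_le_iff of_nat_mult)
        hence "?y \<le> ln (real m * real m)" using N by (subst ln_le_cancel_iff) auto
        also have "\<dots> = 2 * ln (real m)" using m by (simp add: ln_mult)
        finally have y2: "?y \<le> 2 * ln (real m)" .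
        have lm: "ln (real m) > 0" "ln (real m) \<le> ?y" using m N by auto
        have "mult_ext (small_weight ?y) n \<le> mult_ext (small_weight (2 * ln (real m))) n"
          using m y y2 by (intro mult_ext_mono small_weight_mono small_weight_nonneg) auto
        moreover have "(\<alpha> m)\<^sup>2 / ?y \<le> (\<alpha> m)\<^sup>2 / ln (real m)"
          using lm by (intro divide_left_mono) auto
        ultimately show "(\<alpha> (N div n))\<^sup>2 / ?y * mult_ext (small_weight ?y) n \<le> G (N div n) n"
          unfolding m_def[symmetric] G_def using lm m by (intro mult_mono snn) auto
      qed (use C1 in auto)
      finally show ?thesis .
    qed
    have Gnn: "G m n \<ge> 0" if "m \<ge> 2" "n \<ge> 1" for m n
      unfolding G_def using that
      by (intro mult_nonneg_nonneg divide_nonneg_nonneg mult_ext_nonneg small_weight_nonneg) auto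
    have "(\<Sum>N\<in>{2..X}. ((\<Sum>n\<in>D N. \<alpha> (N div n) * psi1 n) / ln (real N))\<^sup>2)
        \<le> (\<Sum>N\<in>{2..X}. C1 * (\<Sum>n\<in>D N. G (N div n) n))"
      by (intro sum_mono *) auto
    also have "\<dots> = C1 * (\<Sum>N\<in>{2..X}. \<Sum>n\<in>D N. G (N div n) n)" by (simp add: sum_distrib_left)
    also have "\<dots> \<le> C1 * (\<Sum>m\<in>{2..X}. \<Sum>n\<in>{1..m}. G m n)"
    proof (intro mult_left_mono sum_divisor_pairs_le)
      fix N n assume N: "N \<in> {2..X}" and n: "n \<in> D N"
      show "N div n \<in> {2..X} \<and> n \<in> {1..N div n}"
        using N n le_trans[OF div_le_dividend, of N X n] unfolding D_def by auto
    qed (use C1 Gnn in \<open>auto simp: D_def\<close>)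
    also have "\<dots> \<le> C1 * (\<Sum>m\<in>{2..X}. C2 * (\<alpha> m)\<^sup>2)"
    proof (intro mult_left_mono sum_mono)
      fix m assume m: "m \<in> {2..X}"
      have "(\<Sum>n\<in>{1..m}. G m n) = (\<alpha> m)\<^sup>2 / ln (real m) * (\<Sum>n\<in>{1..m}. mult_ext (small_weight (2 * ln (real m))) n)"
        by (simp add: G_def sum_distrib_left)
      also have "\<dots> \<le> (\<alpha> m)\<^sup>2 / ln (real m) * (C2 * ln (real m))"
        using m by (intro mult_left_mono C2) auto
      also have "\<dots> = C2 * (\<alpha> m)\<^sup>2" using m by simp
      finally show "(\<Sum>n\<in>{1..m}. G m n) \<le> C2 * (\<alpha> m)\<^sup>2" .
    qed (use C1 in auto)
    also have "\<dots> \<le> C1 * (\<Sum>m\<in>{1..X}. C2 * (\<alpha> m)\<^sup>2)"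
      using C1 C2 by (intro mult_left_mono sum_mono2) auto
    finally show "(\<Sum>N\<in>{2..X}. ((\<Sum>n | n dvd N \<and> 2 \<le> n \<and> n \<le> N div n. \<alpha> (N div n) * psi1 n) / ln (real N))\<^sup>2)
        \<le> C1 * C2 * (\<Sum>m\<in>{1..X}. (\<alpha> m)\<^sup>2)"
      by (simp add: D_def sum_distrib_left mult.assoc)
  qed (use C1 C2 in auto)
qed

text \<open>Primes up to exp(1/e) form a finite set, whose Euler product is the constant; every
  larger prime satisfies \<open>1 \<le> e * ln p\<close>, so that its value, at most 1, is small
  enough.\<close>

lemma sum_divisors_powr_le:
  assumes "a > 0" "e > 0"
  obtains K where "K > 0" "\<And>N. N > 0 \<Longrightarrow> (\<Sum>n | n dvd N. real n powr (- a)) \<le> K * real N powr e"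
proof -
  define P where "P = {p::nat. prime p \<and> real p \<le> exp (1 / e)}"
  have P: "finite P" "\<And>p. p \<in> P \<Longrightarrow> prime p \<and> real p powr (- a) < 1"
  proof -
    show "finite P" unfolding P_def by simp
    fix p assume p: "p \<in> P"
    hence "1 < real p" using prime_gt_1_nat[of p] by (simp add: P_def)
    hence "real p powr (- a) < real p powr 0" using assms by (intro powr_less_mono) auto
    thus "prime p \<and> real p powr (- a) < 1" using p by (auto simp: P_def prime_gt_0_nat)
  qed
  show ?thesis
  proof (rule that[of "\<Prod>p\<in>P. 1 / (1 - real p powr (- a))"])
    show "(\<Prod>p\<in>P. 1 / (1 - real p powr (- a))) > 0"
      using P by (intro prod_pos) auto
    fix N :: nat assume "N > 0"
    show "(\<Sum>n | n dvd N. real n powr (- a)) \<le> (\<Prod>p\<in>P. 1 / (1 - real p powr (- a))) * real N powr e"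
    proof (rule sum_divisors_le_euler_product[OF completely_multiplicative_powr _ P])
      fix p :: nat assume p: "prime p" "p \<notin> P"
      hence "exp (1 / e) < real p" by (simp add: P_def)
      hence "1 / e < ln (real p)" using p by (metis exp_less_cancel_iff exp_ln of_nat_0_less_iff prime_gt_0_nat)
      hence "1 \<le> e * ln (real p)" using assms by (simp add: field_simps)
      moreover have "real p powr (- a) \<le> 1"
        using assms prime_ge_1_nat[OF p(1)] by (simp add: powr_minus field_simps ge_one_powr_ge_zero)
      ultimately show "real p powr (- a) \<le> e * ln (real p)" by linarith
    qed (use assms \<open>N > 0\<close> in auto)
  qed
qed

lemma psi1_le: "n > 0 \<Longrightarrow> psi1 n \<le> real n powr (-5/8)"
proof (rule completely_multiplicative_mono[OF completely_multiplicative_mult_ext completely_multiplicative_powr])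
  fix p :: nat assume p: "prime p"
  hence p0: "real p > 0" by (simp add: prime_gt_0_nat)
  have "ln (real p) / real p \<le> real p powr (3/8) / real p"
    using p0 by (intro divide_right_mono ln_le_powr_3_8) auto
  also have "\<dots> = real p powr (3/8 - 1)" using p0 by (simp only: powr_diff) simp
  finally show "psi1 p \<le> real p powr (-5/8)" using p by simp
qed auto

text \<open>Write n^(-5/8) = n^(-9/16) * n^(-1/16). The square n^(-9/8) of the first factor is
  summable over all \<open>n\<close>; for the second, the divisor sum is bounded because
  \<open>n\<close> is at least the square root of \<open>N\<close>. Of the logarithm only
  \<open>ln N \<ge> ln 2\<close> is used.\<close>

lemma bound_large_divisors:
  obtains C where "C > 0"
    "\<And>\<alpha> X. (\<And>n. \<alpha> n \<ge> 0) \<Longrightarrow> (\<Sum>N\<in>{2..X}. ((\<Sum>n | n dvd N \<and> N div n < n. \<alpha> (N div n) * psi1 n) / ln (real N))\<^sup>2)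
        \<le> C * (\<Sum>m\<in>{1..X}. (\<alpha> m)\<^sup>2)"
proof -
  obtain K where K: "K > 0" "\<And>N. N > 0 \<Longrightarrow> (\<Sum>n | n dvd N. real n powr (- (1/16))) \<le> K * real N powr (1/32)"
    using sum_divisors_powr_le[of "1/16" "1/32"] by auto
  have sm: "summable (\<lambda>n. real n powr (-9/8))" by (simp add: summable_real_powr_iff)
  define Z where "Z = (\<Sum>n. real n powr (-9/8))"
  have Z: "(\<Sum>n\<in>{1..X}. real n powr (-9/8)) \<le> Z" for X
    unfolding Z_def by (intro sum_le_suminf sm) auto
  have "Z > 0" using Z[of 1] by simp
  show ?thesis
  proof (rule that[of "K / (ln 2)\<^sup>2 * Z"])
    fix \<alpha> :: "nat \<Rightarrow> real" and X :: nat assume nn: "\<And>n. \<alpha> n \<ge> 0"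
    define D where "D = (\<lambda>N::nat. {n. n dvd N \<and> N div n < n})"
    define G where "G = (\<lambda>m n. (\<alpha> m)\<^sup>2 * real n powr (-9/8))"
    have *: "((\<Sum>n\<in>D N. \<alpha> (N div n) * psi1 n) / ln (real N))\<^sup>2 \<le> K / (ln 2)\<^sup>2 * (\<Sum>n\<in>D N. G (N div n) n)"
      if N: "N \<ge> 2" for N
    proof -
      have fin: "finite (D N)" using N by (intro finite_subset[of "D N" "{n. n dvd N}"]) (auto simp: D_def)
      have npos: "n > 0" if "n \<in> D N" for n using that N by (auto simp: D_def)
      have "(\<Sum>n\<in>D N. \<alpha> (N div n) * psi1 n) \<le> (\<Sum>n\<in>D N. (\<alpha> (N div n) * real n powr (-9/16)) * real n powr (-1/16))"
      proof (intro sum_mono)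
        fix n assume "n \<in> D N"
        have "\<alpha> (N div n) * psi1 n \<le> \<alpha> (N div n) * real n powr (-5/8)"
          by (intro mult_left_mono psi1_le npos nn \<open>n \<in> D N\<close>)
        also have "real n powr (-5/8) = real n powr (-9/16) * real n powr (-1/16)"
          by (simp flip: powr_add)
        finally show "\<alpha> (N div n) * psi1 n \<le> (\<alpha> (N div n) * real n powr (-9/16)) * real n powr (-1/16)"
          by (simp add: mult.assoc)
      qed
      moreover have "0 \<le> (\<Sum>n\<in>D N. \<alpha> (N div n) * psi1 n)"
        using npos by (intro sum_nonneg mult_nonneg_nonneg nn mult_ext_nonneg) auto
      ultimately have "(\<Sum>n\<in>D N. \<alpha> (N div n) * psi1 n)\<^sup>2 \<le>
          (\<Sum>n\<in>D N. (\<alpha> (N div n) * real n powr (-9/16)) * real n powr (-1/16))\<^sup>2"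
        by (intro power_mono)
      also have "\<dots> \<le> (\<Sum>n\<in>D N. (\<alpha> (N div n) * real n powr (-9/16))\<^sup>2) * (\<Sum>n\<in>D N. (real n powr (-1/16))\<^sup>2)"
        by (rule Cauchy_Schwarz_ineq_sum)
      also have "(\<Sum>n\<in>D N. (\<alpha> (N div n) * real n powr (-9/16))\<^sup>2) = (\<Sum>n\<in>D N. G (N div n) n)"
        by (simp add: G_def power_mult_distrib) (simp add: power2_eq_square flip: powr_add)
      also have "(\<Sum>n\<in>D N. (real n powr (-1/16))\<^sup>2) \<le> K"
      proof -
        \<comment> \<open>One of the two factors n^(-1/16) is traded for N^(-1/32), exactly the
          growth allowed by \<open>K\<close>.\<close>
        have "(\<Sum>n\<in>D N. (real n powr (-1/16))\<^sup>2) \<le> (\<Sum>n\<in>D N. real N powr (-(1/32)) * real n powr (-(1/16)))"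
        proof (intro sum_mono)
          fix n assume n: "n \<in> D N"
          have "N = (N div n) * n" using n by (simp add: D_def)
          also have "\<dots> \<le> n * n" using n by (intro mult_right_mono) (auto simp: D_def)
          finally have "real N \<le> real n * real n" by (metis of_nat_le_iff of_nat_mult)
          hence "(real n * real n) powr (-(1/32)) \<le> real N powr (-(1/32))"
            using N by (intro powr_mono2') auto
          also have "(real n * real n) powr (-(1/32)) = real n powr (-(1/16))"
            by (simp add: powr_mult flip: powr_add)
          finally show "(real n powr (-1/16))\<^sup>2 \<le> real N powr (-(1/32)) * real n powr (-(1/16))"
            by (simp add: power2_eq_square mult_right_mono)
        qed
        also have "\<dots> \<le> real N powr (-(1/32)) * (\<Sum>n | n dvd N. real n powr (-(1/16)))"
          unfolding sum_distrib_left[symmetric] using N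
          by (intro mult_left_mono sum_mono2) (auto simp: D_def)
        also have "\<dots> \<le> real N powr (-(1/32)) * (K * real N powr (1/32))"
          using N by (intro mult_left_mono K) auto
        also have "\<dots> = K * (real N powr (-(1/32)) * real N powr (1/32))" by simp
        also have "\<dots> = K" using N by (simp flip: powr_add)
        finally show ?thesis .
      qed
      finally have 1: "(\<Sum>n\<in>D N. \<alpha> (N div n) * psi1 n)\<^sup>2 \<le> (\<Sum>n\<in>D N. G (N div n) n) * K"
        by (simp add: G_def sum_nonneg mult_left_mono)
      have "(\<Sum>n\<in>D N. \<alpha> (N div n) * psi1 n)\<^sup>2 / (ln (real N))\<^sup>2 \<le> (\<Sum>n\<in>D N. G (N div n) n) * K / (ln 2)\<^sup>2"
        using N by (intro frac_le 1 power_mono) (auto simp: G_def intro!: sum_nonneg mult_nonneg_nonneg less_imp_le[OF K(1)])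
      thus ?thesis by (simp add: power_divide mult.commute)
    qed
    have "(\<Sum>N\<in>{2..X}. ((\<Sum>n\<in>D N. \<alpha> (N div n) * psi1 n) / ln (real N))\<^sup>2)
        \<le> (\<Sum>N\<in>{2..X}. K / (ln 2)\<^sup>2 * (\<Sum>n\<in>D N. G (N div n) n))"
      by (intro sum_mono *) auto
    also have "\<dots> = K / (ln 2)\<^sup>2 * (\<Sum>N\<in>{2..X}. \<Sum>n\<in>D N. G (N div n) n)" by (simp add: sum_distrib_left)
    also have "\<dots> \<le> K / (ln 2)\<^sup>2 * (\<Sum>m\<in>{1..X}. \<Sum>n\<in>{1..X}. G m n)"
    proof (intro mult_left_mono sum_divisor_pairs_le)
      fix N n assume N: "N \<in> {2..X}" and n: "n \<in> D N"
      hence "N = (N div n) * n" by (simp add: D_def)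
      hence "N div n > 0" "n > 0" using N by (auto intro!: Nat.gr0I simp: D_def)
      moreover have "n \<le> N" using n N by (auto simp: D_def dvd_imp_le)
      moreover have "N div n \<le> X"
        by (rule le_trans[OF div_le_dividend]) (use N in simp)
      ultimately show "N div n \<in> {1..X} \<and> n \<in> {1..X}"
        using N by simp
    qed (use K in \<open>auto simp: D_def G_def\<close>)
    also have "\<dots> \<le> K / (ln 2)\<^sup>2 * (\<Sum>m\<in>{1..X}. (\<alpha> m)\<^sup>2 * Z)"
      unfolding G_def sum_distrib_left[symmetric] using K(1)
      by (intro mult_left_mono sum_mono Z) auto
    finally show "(\<Sum>N\<in>{2..X}. ((\<Sum>n | n dvd N \<and> N div n < n. \<alpha> (N div n) * psi1 n) / ln (real N))\<^sup>2)
        \<le> K / (ln 2)\<^sup>2 * Z * (\<Sum>m\<in>{1..X}. (\<alpha> m)\<^sup>2)"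
      by (simp add: D_def sum_distrib_left[symmetric] mult_ac)
  qed (use K \<open>Z > 0\<close> in auto)
qed

lemma volterra_coefficients_bounded:
  obtains C where "C > 0"
    "\<And>\<alpha> X. (\<And>n. \<alpha> n \<ge> 0) \<Longrightarrow> (\<Sum>N\<in>{2..X}. ((\<Sum>n | n dvd N \<and> 2 \<le> n. \<alpha> (N div n) * psi1 n) / ln (real N))\<^sup>2)
        \<le> C * (\<Sum>m\<in>{1..X}. (\<alpha> m)\<^sup>2)"
proof -
  obtain C1 where C1: "C1 > 0"
    "\<And>\<alpha> X. (\<And>n. \<alpha> n \<ge> 0) \<Longrightarrow> (\<Sum>N\<in>{2..X}. ((\<Sum>n | n dvd N \<and> 2 \<le> n \<and> n \<le> N div n. \<alpha> (N div n) * psi1 n) / ln (real N))\<^sup>2)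
        \<le> C1 * (\<Sum>m\<in>{1..X}. (\<alpha> m)\<^sup>2)"
    using bound_small_divisors by blast
  obtain C2 where C2: "C2 > 0"
    "\<And>\<alpha> X. (\<And>n. \<alpha> n \<ge> 0) \<Longrightarrow> (\<Sum>N\<in>{2..X}. ((\<Sum>n | n dvd N \<and> N div n < n. \<alpha> (N div n) * psi1 n) / ln (real N))\<^sup>2)
        \<le> C2 * (\<Sum>m\<in>{1..X}. (\<alpha> m)\<^sup>2)"
    using bound_large_divisors by blast
  show ?thesis
  proof (rule that[of "2 * C1 + 2 * C2"])
    fix \<alpha> :: "nat \<Rightarrow> real" and X :: nat assume nn: "\<And>n. \<alpha> n \<ge> 0"
    define u where "u = (\<lambda>N. (\<Sum>n | n dvd N \<and> 2 \<le> n \<and> n \<le> N div n. \<alpha> (N div n) * psi1 n) / ln (real N))"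
    define v where "v = (\<lambda>N. (\<Sum>n | n dvd N \<and> N div n < n. \<alpha> (N div n) * psi1 n) / ln (real N))"
    have "(\<Sum>N\<in>{2..X}. ((\<Sum>n | n dvd N \<and> 2 \<le> n. \<alpha> (N div n) * psi1 n) / ln (real N))\<^sup>2)
          \<le> (\<Sum>N\<in>{2..X}. 2 * (u N)\<^sup>2 + 2 * (v N)\<^sup>2)"
    proof (intro sum_mono)
      fix N assume N: "N \<in> {2..X}"
      have fin: "finite {n. n dvd N \<and> Q n}" for Q using N by simp
      \<comment> \<open>In the second set \<open>2 \<le> n\<close> is automatic: for n = 1 the
        quotient is \<open>N\<close> itself.\<close>
      have "{n. n dvd N \<and> 2 \<le> n} = {n. n dvd N \<and> 2 \<le> n \<and> n \<le> N div n} \<union> {n. n dvd N \<and> N div n < n}"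
      proof -
        have "2 \<le> n" if "n dvd N" "N div n < n" for n
          using that N by (cases "n = 0 \<or> n = 1") auto
        thus ?thesis by auto
      qed
      hence "(\<Sum>n | n dvd N \<and> 2 \<le> n. \<alpha> (N div n) * psi1 n) / ln (real N) = u N + v N"
        unfolding u_def v_def add_divide_distrib[symmetric]
        by (subst sum.union_disjoint[symmetric]) (use fin in auto)
      moreover have "(u N + v N)\<^sup>2 \<le> 2 * (u N)\<^sup>2 + 2 * (v N)\<^sup>2"
        using zero_le_power2[of "u N - v N"] by (simp add: power2_eq_square algebra_simps)
      ultimately show "((\<Sum>n | n dvd N \<and> 2 \<le> n. \<alpha> (N div n) * psi1 n) / ln (real N))\<^sup>2 \<le> 2 * (u N)\<^sup>2 + 2 * (v N)\<^sup>2"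
        by simp
    qed
    also have "\<dots> = 2 * (\<Sum>N\<in>{2..X}. (u N)\<^sup>2) + 2 * (\<Sum>N\<in>{2..X}. (v N)\<^sup>2)"
      by (simp add: sum.distrib sum_distrib_left)
    also have "\<dots> \<le> 2 * (C1 * (\<Sum>m\<in>{1..X}. (\<alpha> m)\<^sup>2)) + 2 * (C2 * (\<Sum>m\<in>{1..X}. (\<alpha> m)\<^sup>2))"
      unfolding u_def v_def by (intro add_mono mult_left_mono C1 C2 nn) auto
    finally show "(\<Sum>N\<in>{2..X}. ((\<Sum>n | n dvd N \<and> 2 \<le> n. \<alpha> (N div n) * psi1 n) / ln (real N))\<^sup>2)
        \<le> (2 * C1 + 2 * C2) * (\<Sum>m\<in>{1..X}. (\<alpha> m)\<^sup>2)" by (simp add: algebra_simps)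
  qed (use C1 C2 in auto)
qed

section \<open>Unboundedness for \<open>\<lambda> > 1\<close>\<close>

lemma divisors_prime_power_mult:
  fixes p Q :: nat
  assumes "prime p" "\<not> p dvd Q" "Q > 0"
  shows "bij_betw (\<lambda>(i, M). p ^ i * M) ({..k} \<times> {M. M dvd Q}) {N. N dvd p ^ k * Q}"
proof (rule bij_betwI')
  have p0: "p > 0" using assms by (simp add: prime_gt_0_nat)
  have mult: "multiplicity p (p ^ i * M) = i" if "M dvd Q" for i M
  proof -
    have "\<not> p dvd M" using that assms(2) by (meson dvd_trans)
    moreover have "M \<noteq> 0" using that assms(3) by auto
    ultimately show ?thesis using assms(1)
      by (simp add: prime_elem_multiplicity_mult_distrib prime_imp_prime_elem not_dvd_imp_multiplicity_0 prime_gt_0_nat)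
  qed
  show "((case x of (i, M) \<Rightarrow> p ^ i * M) = (case y of (i, M) \<Rightarrow> p ^ i * M)) = (x = y)"
    if "x \<in> {..k} \<times> {M. M dvd Q}" "y \<in> {..k} \<times> {M. M dvd Q}" for x y
    using that mult p0 by (auto split: prod.splits) (metis mult_left_cancel power_eq_0_iff neq0_conv)+
  show "(case x of (i, M) \<Rightarrow> p ^ i * M) \<in> {N. N dvd p ^ k * Q}"
    if "x \<in> {..k} \<times> {M. M dvd Q}" for x
    using that by (auto intro!: mult_dvd_mono le_imp_power_dvd)
  show "\<exists>x\<in>{..k} \<times> {M. M dvd Q}. N = (case x of (i, M) \<Rightarrow> p ^ i * M)"
    if N: "N \<in> {N. N dvd p ^ k * Q}" for N
  proof -
    obtain u M where "N = u * M" "u dvd p ^ k" "M dvd Q"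
      using N division_decomp[of N "p ^ k" Q] by auto
    moreover obtain i where "i \<le> k" "u = p ^ i"
      using \<open>u dvd p ^ k\<close> assms(1) by (auto simp: divides_primepow_nat)
    ultimately show ?thesis by (intro bexI[of _ "(i, M)"]) auto
  qed
qed

text \<open>Since \<open>p\<close> does not divide \<open>M\<close>, the divisors \<open>n\<close>
  and \<open>p * n\<close> are all distinct. Dropping the higher powers of \<open>p\<close> gives a
  bound that does not depend on \<open>i\<close>.\<close>

lemma sum_divisors_prime_mult_ge:
  fixes h :: "nat \<Rightarrow> real"
  assumes h: "completely_multiplicative h" "\<And>p. prime p \<Longrightarrow> h p \<ge> 0"
    and p: "prime p" "\<not> p dvd M" "M > 0" and i: "i > 0"
  shows "(1 + h p) * (\<Sum>n | n dvd M. h n) \<le> (\<Sum>n | n dvd p ^ i * M. h n)"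
proof -
  have p0: "p > 0" using p by (simp add: prime_gt_0_nat)
  have "(1 + h p) * (\<Sum>n | n dvd M. h n) = (\<Sum>n | n dvd M. h n) + (\<Sum>n | n dvd M. h (p * n))"
  proof -
    have "h (p * n) = h p * h n" if "n dvd M" for n
      using that p p0 by (intro completely_multiplicative_mult[OF h(1)]) (auto intro!: Nat.gr0I)
    thus ?thesis by (simp add: distrib_right sum_distrib_left sum.distrib)
  qed
  also have "(\<Sum>n | n dvd M. h (p * n)) = sum h ((*) p ` {n. n dvd M})"
    using p0 by (subst sum.reindex) (auto intro: inj_onI)
  also have "(\<Sum>n | n dvd M. h n) + sum h ((*) p ` {n. n dvd M}) = sum h ({n. n dvd M} \<union> (*) p ` {n. n dvd M})"
  proof (intro sum.union_disjoint[symmetric])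
    show "{n. n dvd M} \<inter> (*) p ` {n. n dvd M} = {}"
      using p(2) by (auto dest: dvd_mult_left)
  qed (use p in auto)
  also have "\<dots> \<le> (\<Sum>n | n dvd p ^ i * M. h n)"
  proof (rule sum_mono2)
    show "finite {n. n dvd p ^ i * M}" using p p0 by simp
    have "p * n dvd p ^ i * M" if "n dvd M" for n
      using that i by (intro mult_dvd_mono dvd_power) auto
    thus "{n. n dvd M} \<union> (*) p ` {n. n dvd M} \<subseteq> {n. n dvd p ^ i * M}" by auto
    show "0 \<le> h n" if "n \<in> {n. n dvd p ^ i * M} - ({n. n dvd M} \<union> (*) p ` {n. n dvd M})" for n
      using that p p0 by (intro completely_multiplicative_nonneg[OF h]) (auto intro!: Nat.gr0I)
  qed
  finally show ?thesis .
qed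

text \<open>The test function is the indicator of the divisors of a \<open>k\<close>-th power. The factor
  \<open>k / (k + 1)\<close> is the proportion of exponents in \<open>{0..k}\<close> that are positive; it tends to 1, which is
  why a large but fixed \<open>k\<close> suffices for every \<open>\<lambda> > 1\<close>.\<close>

lemma average_sum_divisors_ge:
  fixes h :: "nat \<Rightarrow> real"
  assumes h: "completely_multiplicative h" "\<And>p. prime p \<Longrightarrow> h p \<ge> 0"
    and "finite P" "\<And>p. p \<in> P \<Longrightarrow> prime p"
  shows "real (card {N. N dvd (\<Prod>p\<in>P. p ^ k)}) * (\<Prod>p\<in>P. 1 + real k / (real k + 1) * h p)
           \<le> (\<Sum>N | N dvd (\<Prod>p\<in>P. p ^ k). \<Sum>n | n dvd N. h n)"
  using assms(3,4)
proof (induction P rule: finite_induct)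
  case empty
  have "{n::nat. n dvd 1} = {1}" by auto
  thus ?case using completely_multiplicative_1[OF h(1)] by simp
next
  case (insert p P)
  define Q where "Q = (\<Prod>p\<in>P. p ^ k)"
  define \<sigma> where "\<sigma> = (\<lambda>N. \<Sum>n | n dvd N. h n)"
  have p: "prime p" using insert.prems by auto
  have Q: "Q > 0" unfolding Q_def using insert.prems by (intro prod_pos) (auto simp: prime_gt_0_nat)
  have "\<not> p dvd Q"
  proof
    assume "p dvd Q"
    then obtain q where "q \<in> P" "p dvd q ^ k"
      using insert.hyps p by (auto simp: Q_def prime_dvd_prod_iff)
    hence "p = q" using p insert.prems prime_dvd_power primes_dvd_imp_eq by blast
    thus False using \<open>q \<in> P\<close> insert.hyps by simp
  qed
  note bij = divisors_prime_power_mult[OF p this Q, of k]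
  have fin: "finite {M. M dvd Q}" using Q by simp
  have card: "card {N. N dvd p ^ k * Q} = (k + 1) * card {M. M dvd Q}"
    using bij_betw_same_card[OF bij] by (simp add: card_cartesian_product)
  have "(\<Sum>N | N dvd p ^ k * Q. \<sigma> N) = (\<Sum>(i, M)\<in>{..k} \<times> {M. M dvd Q}. \<sigma> (p ^ i * M))"
    by (subst sum.reindex_bij_betw[OF bij, symmetric]) (simp add: case_prod_unfold)
  also have "\<dots> = (\<Sum>i\<in>{..k}. \<Sum>M | M dvd Q. \<sigma> (p ^ i * M))"
    using fin by (subst sum.cartesian_product) auto
  also have "\<dots> = (\<Sum>M | M dvd Q. \<sigma> M) + (\<Sum>i\<in>{1..k}. \<Sum>M | M dvd Q. \<sigma> (p ^ i * M))"
  proof -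
    have "{..k} = insert 0 {1..k}" by auto
    thus ?thesis by simp
  qed
  also have "\<dots> \<ge> (\<Sum>M | M dvd Q. \<sigma> M) + (\<Sum>i\<in>{1..k}. \<Sum>M | M dvd Q. (1 + h p) * \<sigma> M)"
  proof (intro add_left_mono sum_mono)
    fix i M assume i: "i \<in> {1..k}" and M: "M \<in> {M. M dvd Q}"
    have "\<not> p dvd M" using M \<open>\<not> p dvd Q\<close> by (meson dvd_trans mem_Collect_eq)
    moreover have "M > 0" using M Q by (auto intro!: Nat.gr0I)
    ultimately show "(1 + h p) * \<sigma> M \<le> \<sigma> (p ^ i * M)"
      unfolding \<sigma>_def using i p h by (intro sum_divisors_prime_mult_ge) auto
  qed
  also have "(\<Sum>i\<in>{1..k}. \<Sum>M | M dvd Q. (1 + h p) * \<sigma> M) = real k * ((1 + h p) * (\<Sum>M | M dvd Q. \<sigma> M))"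
    by (simp add: sum_distrib_left)
  \<comment> \<open>Of the k + 1 exponents of \<open>p\<close>, the exponent 0 gains nothing and the
    other k gain the factor \<open>1 + h p\<close>.\<close>
  also have "(\<Sum>M | M dvd Q. \<sigma> M) + real k * ((1 + h p) * (\<Sum>M | M dvd Q. \<sigma> M)) =
             (real k + 1) * (1 + real k / (real k + 1) * h p) * (\<Sum>M | M dvd Q. \<sigma> M)"
    by (simp add: field_simps)
  finally have "(real k + 1) * (1 + real k / (real k + 1) * h p) * (\<Sum>M | M dvd Q. \<sigma> M) \<le> (\<Sum>N | N dvd p ^ k * Q. \<sigma> N)" .
  moreover have "(real k + 1) * (1 + real k / (real k + 1) * h p) *
          (real (card {N. N dvd Q}) * (\<Prod>p\<in>P. 1 + real k / (real k + 1) * h p)) \<le>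
        (real k + 1) * (1 + real k / (real k + 1) * h p) * (\<Sum>M | M dvd Q. \<sigma> M)"
    unfolding \<sigma>_def Q_def using insert h(2)[OF p] by (intro mult_left_mono insert.IH) auto
  ultimately have "real (card {N. N dvd p ^ k * Q}) *
      ((1 + real k / (real k + 1) * h p) * (\<Prod>p\<in>P. 1 + real k / (real k + 1) * h p)) \<le>
      (\<Sum>N | N dvd p ^ k * Q. \<sigma> N)"
    unfolding card by (simp only: of_nat_mult of_nat_add of_nat_1 mult.assoc mult.left_commute)
  thus ?case using insert.hyps by (simp add: Q_def \<sigma>_def)
qed

text \<open>Assumption \<open>bd\<close> is the norm inequality for the indicator function of the
  divisors of \<open>Q\<close>, whose squared norm is the number of these divisors.\<close>

lemma lambda_le_1_if_bounded:
  fixes \<psi> :: "nat \<Rightarrow> real"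
  assumes "lam > 0" and cm: "completely_multiplicative \<psi>"
    and \<psi>: "\<And>p. prime p \<Longrightarrow> \<psi> p = lam * ln (real p) / real p"
    and bd: "\<And>Q. Q > 0 \<Longrightarrow>
      (\<Sum>N | N dvd Q. ((\<Sum>n | n dvd N \<and> 2 \<le> n. \<psi> n) / ln (real N))\<^sup>2) \<le> C\<^sup>2 * real (card {N. N dvd Q})"
    and "C \<ge> 0"
  shows "lam \<le> 1"
proof (rule ccontr)
  assume "\<not> lam \<le> 1"
  \<comment> \<open>The condition k (lambda - 1) > 1 says exactly that lambda k / (k + 1) >
    1.\<close>
  then obtain k :: nat where k: "1 / (lam - 1) < real k" using reals_Archimedean2 by blast
  have "1 / (lam - 1) > 0" using \<open>\<not> lam \<le> 1\<close> by simp
  hence k0: "k > 0" using k by (intro Nat.gr0I) auto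
  define \<kappa> where "\<kappa> = real k / (real k + 1)"
  have \<kappa>: "\<kappa> > 0" "\<kappa> * lam > 1" using k k0 \<open>\<not> lam \<le> 1\<close> by (auto simp: \<kappa>_def field_simps)
  have nn: "\<psi> p \<ge> 0" if "prime p" for p using that \<psi> \<open>lam > 0\<close> by simp
  obtain B where B: "\<And>P. finite P \<Longrightarrow> (\<And>p. p \<in> P \<Longrightarrow> p > 0) \<Longrightarrow> (\<Sum>p\<in>P. (ln (real p) / real p)\<^sup>2) \<le> B"
    using sum_primes_ln_over_squared_bounded by blast
  \<comment> \<open>Collects the error of \<open>mertens_lower\<close> and the second-order terms of
    the product.\<close>
  define c where "c = exp (\<kappa> * lam * (- 1 - 4 * ln 4) - (\<kappa> * lam)\<^sup>2 * B)"
  define K where "K = 1 + C * (real k * (3 * ln 4))"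
  have main: "c * real y powr (\<kappa> * lam) \<le> K * real y" if y: "y > 0" for y
  proof -
    define P where "P = {p. prime p \<and> p \<le> y}"
    define Q where "Q = (\<Prod>p\<in>P. p ^ k)"
    have P: "finite P" "\<And>p. p \<in> P \<Longrightarrow> prime p" by (auto simp: P_def)
    have Q: "Q > 0" unfolding Q_def using P by (intro prod_pos) (auto simp: prime_gt_0_nat)
    define d where "d = real (card {N. N dvd Q})"
    have "d > 0" using Q by (auto simp: d_def card_gt_0_iff intro: exI[of _ 1])
    define \<tau> where "\<tau> = (\<lambda>N. \<Sum>n | n dvd N \<and> 2 \<le> n. \<psi> n)"
    have lnQ: "ln (real Q) \<le> real k * (3 * ln 4) * real y" "ln (real Q) \<ge> 0"
    proof -
      have "ln (real Q) = (\<Sum>p\<in>P. ln (real p ^ k))"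
        unfolding Q_def by (simp, subst ln_prod) (use P in \<open>auto simp: prime_gt_0_nat\<close>)
      also have "\<dots> = real k * (\<Sum>p\<in>P. ln (real p))"
        by (simp add: ln_realpow sum_distrib_left)
      also have "\<dots> \<le> real k * (3 * ln 4 * real y)"
        unfolding P_def by (intro mult_left_mono chebyshev_upper) auto
      finally show "ln (real Q) \<le> real k * (3 * ln 4) * real y" by (simp add: mult_ac)
      show "ln (real Q) \<ge> 0" using Q by simp
    qed
    have "c * real y powr (\<kappa> * lam) = exp (\<kappa> * lam * (ln (real y) - 1 - 4 * ln 4) - (\<kappa> * lam)\<^sup>2 * B)"
      using y by (simp add: c_def powr_def algebra_simps flip: exp_add)
    also have "\<dots> \<le> exp (\<kappa> * lam * (\<Sum>p\<in>P. ln (real p) / real p) - (\<kappa> * lam)\<^sup>2 * (\<Sum>p\<in>P. (ln (real p) / real p)\<^sup>2))"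
    proof -
      have "ln (real y) - 1 - 4 * ln 4 \<le> (\<Sum>p\<in>P. ln (real p) / real p)"
        unfolding P_def by (rule mertens_lower[OF y])
      hence "\<kappa> * lam * (ln (real y) - 1 - 4 * ln 4) \<le> \<kappa> * lam * (\<Sum>p\<in>P. ln (real p) / real p)"
        using \<kappa>(2) by (intro mult_left_mono) auto
      moreover have "(\<Sum>p\<in>P. (ln (real p) / real p)\<^sup>2) \<le> B"
        by (rule B[OF P(1)]) (use P(2) prime_gt_0_nat in blast)
      hence "(\<kappa> * lam)\<^sup>2 * (\<Sum>p\<in>P. (ln (real p) / real p)\<^sup>2) \<le> (\<kappa> * lam)\<^sup>2 * B"
        by (intro mult_left_mono) auto
      ultimately show ?thesis by simp
    qed
    also have "\<dots> = (\<Prod>p\<in>P. exp (\<kappa> * \<psi> p - (\<kappa> * \<psi> p)\<^sup>2))"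
      unfolding exp_sum[OF P(1), symmetric] sum_subtractf sum_distrib_left
      by (intro arg_cong[where f = exp] arg_cong2[where f = "(-)"] sum.cong refl)
         (auto simp: \<psi> P_def power_mult_distrib power_divide mult_ac)
    also have "\<dots> \<le> (\<Prod>p\<in>P. 1 + \<kappa> * \<psi> p)"
    proof (intro prod_mono conjI)
      fix p assume "p \<in> P"
      define x where "x = \<kappa> * \<psi> p"
      have x: "x \<ge> 0" unfolding x_def using \<kappa> nn \<open>p \<in> P\<close> P by auto
      \<comment> \<open>Values above 1 do occur for large lambda; there the left-hand side is
        negative.\<close>
      have "x - x\<^sup>2 \<le> ln (1 + x)"
      proof (cases "x \<le> 1")
        case True
        thus ?thesis using x ln_one_plus_pos_lower_bound by blast
      next
        case False
        hence "x * 1 \<le> x * x" by (intro mult_left_mono) auto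
        moreover have "0 \<le> ln (1 + x)" using x by simp
        ultimately show ?thesis by (simp add: power2_eq_square)
      qed
      hence "exp (x - x\<^sup>2) \<le> exp (ln (1 + x))" by simp
      also have "\<dots> = 1 + x" using x by (intro exp_ln) auto
      finally show "exp (\<kappa> * \<psi> p - (\<kappa> * \<psi> p)\<^sup>2) \<le> 1 + \<kappa> * \<psi> p" by (simp add: x_def)
    qed auto
    finally have 1: "c * real y powr (\<kappa> * lam) \<le> (\<Prod>p\<in>P. 1 + \<kappa> * \<psi> p)" .
    have "d * (\<Prod>p\<in>P. 1 + \<kappa> * \<psi> p) \<le> (\<Sum>N | N dvd Q. \<Sum>n | n dvd N. \<psi> n)"
      unfolding d_def Q_def \<kappa>_def by (rule average_sum_divisors_ge[OF cm nn P])
    also have "\<dots> \<le> (\<Sum>N | N dvd Q. 1 + ln (real Q) * (\<tau> N / ln (real N)))"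
    proof (intro sum_mono)
      fix N assume "N \<in> {N. N dvd Q}"
      hence N: "N dvd Q" "N > 0" "N \<le> Q" using Q by (auto intro!: Nat.gr0I dest: dvd_imp_le)
      have set: "{n. n dvd N} = insert 1 {n. n dvd N \<and> 2 \<le> n}"
        using N by (auto simp: not_less_eq_eq)
      have "(\<Sum>n | n dvd N. \<psi> n) = 1 + \<tau> N"
        unfolding set \<tau>_def using N completely_multiplicative_1[OF cm] by (subst sum.insert) auto
      \<comment> \<open>Replaces log N by its maximum log Q over the divisors. At N = 1 both sides
        are 0.\<close>
      also have "\<tau> N \<le> ln (real Q) * (\<tau> N / ln (real N))"
      proof (cases "N = 1")
        case True
        hence "{n. n dvd N \<and> 2 \<le> n} = {}" by auto
        thus ?thesis by (simp only: \<tau>_def sum.empty)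
      next
        case False
        hence "ln (real N) > 0" using N by simp
        moreover have "ln (real N) \<le> ln (real Q)" using N by simp
        moreover have "\<tau> N \<ge> 0" unfolding \<tau>_def
          by (intro sum_nonneg completely_multiplicative_nonneg[OF cm nn]) auto
        ultimately have "\<tau> N * ln (real N) \<le> ln (real Q) * \<tau> N"
          by (metis mult.commute mult_right_mono)
        thus ?thesis using \<open>ln (real N) > 0\<close> by (simp add: field_simps)
      qed
      finally show "(\<Sum>n | n dvd N. \<psi> n) \<le> 1 + ln (real Q) * (\<tau> N / ln (real N))" by simp
    qed
    also have "\<dots> = d + ln (real Q) * (\<Sum>N | N dvd Q. \<tau> N / ln (real N))"
      by (simp add: sum.distrib sum_distrib_left d_def)
    also have "\<dots> \<le> d + ln (real Q) * (C * d)"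
    proof (rule add_left_mono, rule mult_left_mono[OF _ lnQ(2)], rule power2_le_imp_le)
      \<comment> \<open>Cauchy-Schwarz against the constant 1 passes from the mean square in
        \<open>bd\<close> to the mean.\<close>
      have "(\<Sum>N | N dvd Q. 1 * (\<tau> N / ln (real N)))\<^sup>2 \<le> (\<Sum>N | N dvd Q. 1\<^sup>2) * (\<Sum>N | N dvd Q. (\<tau> N / ln (real N))\<^sup>2)"
        by (rule Cauchy_Schwarz_ineq_sum)
      also have "\<dots> \<le> d * (C\<^sup>2 * d)"
        using bd[OF Q] by (auto simp: d_def \<tau>_def intro!: mult_left_mono)
      finally show "(\<Sum>N | N dvd Q. \<tau> N / ln (real N))\<^sup>2 \<le> (C * d)\<^sup>2"
        by (simp add: power2_eq_square mult_ac)
    qed (use \<open>C \<ge> 0\<close> \<open>d > 0\<close> in auto)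
    finally have "d * (\<Prod>p\<in>P. 1 + \<kappa> * \<psi> p) \<le> d * (1 + C * ln (real Q))"
      by (simp add: algebra_simps)
    hence "(\<Prod>p\<in>P. 1 + \<kappa> * \<psi> p) \<le> 1 + C * ln (real Q)" using \<open>d > 0\<close> by simp
    also have "\<dots> \<le> real y + C * (real k * (3 * ln 4) * real y)"
      using y lnQ \<open>C \<ge> 0\<close> by (intro add_mono mult_left_mono) auto
    finally show ?thesis using 1 by (simp add: K_def algebra_simps)
  qed
  \<comment> \<open>A positive number above K/c; \<open>y\<close> is taken so large that its power
    with exponent \<open>\<kappa> * lam - 1\<close> reaches \<open>W\<close>.\<close>
  define W where "W = \<bar>K / c\<bar> + 1"
  obtain y :: nat where y: "max 1 (W powr (1 / (\<kappa> * lam - 1))) \<le> real y"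
    using real_arch_simple by blast
  hence "(W powr (1 / (\<kappa> * lam - 1))) powr (\<kappa> * lam - 1) \<le> real y powr (\<kappa> * lam - 1)"
    using \<kappa> by (intro powr_mono2) auto
  hence y: "K / c + 1 \<le> real y powr (\<kappa> * lam - 1)" "y > 0"
    using abs_ge_self[of "K / c"] \<kappa> y by (auto simp: powr_powr W_def simp del: abs_divide)
  have "c > 0" by (simp add: c_def)
  have "real y powr (\<kappa> * lam) = real y powr (\<kappa> * lam - 1) * real y"
    using y by (simp add: powr_diff)
  hence "c * real y powr (\<kappa> * lam - 1) * real y \<le> K * real y"
    using main[OF y(2)] by simp
  hence "real y powr (\<kappa> * lam - 1) \<le> K / c" using y \<open>c > 0\<close> by (simp add: field_simps)
  thus False using y by simp
qed

section \<open>Dirichlet series and the Volterra integral\<close>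

lemma cmod_of_nat_powr: "cmod (of_nat n powr z) = real n powr Re z"
  by (simp add: norm_powr_real_powr)

definition abs_conv_at :: "(nat \<Rightarrow> complex) \<Rightarrow> real \<Rightarrow> bool" where
  "abs_conv_at a \<sigma> \<longleftrightarrow> summable (\<lambda>n. cmod (a n) * real n powr (- \<sigma>))"

lemma norm_dirichlet_term: "cmod (a n * of_nat n powr (- s)) = cmod (a n) * real n powr (- Re s)"
  by (simp add: norm_mult cmod_of_nat_powr)

lemma nat_powr_mono: "x \<le> y \<Longrightarrow> real n powr x \<le> real n powr y"
  by (cases "n = 0") (auto intro: powr_mono)

lemma abs_conv_at_mono:
  assumes "abs_conv_at a \<sigma>" "\<sigma> \<le> \<tau>"
  shows "abs_conv_at a \<tau>"
  unfolding abs_conv_at_def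
  by (rule summable_comparison_test'[OF assms(1)[unfolded abs_conv_at_def], of 0])
     (use assms(2) in \<open>auto intro!: mult_left_mono nat_powr_mono\<close>)

lemma abs_conv_at_le:
  assumes "abs_conv_at a \<sigma>" "\<And>n. cmod (b n) \<le> K * cmod (a n)"
  shows "abs_conv_at b \<sigma>"
  unfolding abs_conv_at_def
proof (rule summable_comparison_test'[of _ 0])
  show "summable (\<lambda>n. K * (cmod (a n) * real n powr (- \<sigma>)))"
    using assms(1) by (intro summable_mult) (simp add: abs_conv_at_def)
  show "norm (cmod (b n) * real n powr (- \<sigma>)) \<le> K * (cmod (a n) * real n powr (- \<sigma>))" for n
    using mult_right_mono[OF assms(2)[of n], of "real n powr (- \<sigma>)"] by (simp add: mult.assoc)
qed

lemma summable_norm_dirichlet_term: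
  assumes "abs_conv_at a \<sigma>" "\<sigma> \<le> Re s"
  shows "summable (\<lambda>n. norm (a n * of_nat n powr (- s)))"
  using abs_conv_at_mono[OF assms] unfolding abs_conv_at_def norm_dirichlet_term .

lemmas summable_dirichlet_term = summable_norm_cancel[OF summable_norm_dirichlet_term]

lemma continuous_on_dirichlet_series:
  assumes "abs_conv_at a \<sigma>"
  shows "continuous_on {s. Re s > \<sigma>} (dirichlet_series a)"
proof (rule uniform_limit_theorem)
  show "uniform_limit {s. Re s > \<sigma>} (\<lambda>n s. \<Sum>i<n. a i * of_nat i powr (- s)) (dirichlet_series a) sequentially"
    unfolding dirichlet_series_def
    by (rule Weierstrass_m_test[OF _ assms[unfolded abs_conv_at_def]])
       (auto simp: norm_dirichlet_term intro!: mult_left_mono nat_powr_mono)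
  have "continuous_on {s. Re s > \<sigma>} (\<lambda>s. a i * of_nat i powr (- s))" for i
    by (cases "i = 0") (auto intro!: continuous_intros continuous_on_powr_complex)
  thus "\<forall>\<^sub>F n in sequentially. continuous_on {s. \<sigma> < Re s} (\<lambda>s. \<Sum>i<n. a i * of_nat i powr - s)"
    by (intro always_eventually allI continuous_on_sum) auto
qed auto

lemma abs_conv_at_over_ln:
  assumes "abs_conv_at a \<sigma>"
  shows "abs_conv_at (\<lambda>n. a n / of_real (ln (real n))) \<sigma>"
proof (rule abs_conv_at_le[OF assms, where K = "1 / ln 2"])
  fix n
  show "cmod (a n / of_real (ln (real n))) \<le> 1 / ln 2 * cmod (a n)"
  proof (cases "n \<ge> 2")
    case True
    hence "cmod (a n) / ln (real n) \<le> cmod (a n) / ln 2"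
      by (intro divide_left_mono mult_pos_pos) auto
    thus ?thesis using True by (simp add: norm_divide)
  next
    case False
    hence "n = 0 \<or> n = 1" by auto
    thus ?thesis by auto
  qed
qed

text \<open>Differentiating n^(-s) produces -ln n, which cancels the denominator for
  \<open>n \<ge> 2\<close>. A constant term has no antiderivative among Dirichlet series, hence
  \<open>e 1 = 0\<close>.\<close>

lemma dirichlet_series_has_derivative:
  assumes e: "abs_conv_at e \<sigma>" "e 1 = 0" and s: "Re s > \<sigma>"
  shows "(dirichlet_series (\<lambda>n. e n / of_real (ln (real n))) has_field_derivative
           - dirichlet_series e s) (at s)"
proof -
  let ?c = "\<lambda>n. e n / of_real (ln (real n)) :: complex"
  have S: "open {s. Re s > \<sigma>}" by (rule open_halfspace_Re_gt)
  have "((\<lambda>s. \<Sum>n. ?c n * of_nat n powr (- s)) has_field_derivative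
          (\<Sum>n. - e n * of_nat n powr (- s))) (at s)"
  proof (rule has_field_derivative_series'(2)[where S = "{s. Re s > \<sigma>}" and ?x0.0 = s])
    show "convex {s. Re s > \<sigma>}" by (rule convex_halfspace_Re_gt)
    show "s \<in> interior {s. Re s > \<sigma>}" using s S by (simp add: interior_open)
    show "summable (\<lambda>n. ?c n * of_nat n powr (- s))"
      by (rule summable_dirichlet_term[OF abs_conv_at_over_ln[OF e(1)]]) (use s in auto)
    show "uniformly_convergent_on {s. Re s > \<sigma>} (\<lambda>n s. \<Sum>i<n. - e i * of_nat i powr (- s))"
      by (rule Weierstrass_m_test'[OF _ e(1)[unfolded abs_conv_at_def]])
         (auto simp: norm_mult cmod_of_nat_powr intro!: mult_left_mono nat_powr_mono)
    fix n :: nat and x :: complex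
    show "((\<lambda>s. ?c n * of_nat n powr (- s)) has_field_derivative - e n * of_nat n powr (- x))
            (at x within {s. Re s > \<sigma>})"
    proof (cases "n \<ge> 2")
      case True
      have "((\<lambda>s. of_nat n powr (- s)) has_field_derivative
              (Ln (of_nat n) * of_nat n powr (- x)) * (- 1)) (at x)"
        using True
        by (intro DERIV_chain2[where g = "\<lambda>s. - s"] has_field_derivative_powr_right) (auto intro!: derivative_eq_intros)
      hence "((\<lambda>s. ?c n * of_nat n powr (- s)) has_field_derivative
              ?c n * ((Ln (of_nat n) * of_nat n powr (- x)) * (- 1))) (at x)"
        by (rule DERIV_cmult)
      moreover have "ln (real n) \<noteq> 0" using True by simp
      hence "?c n * ((Ln (of_nat n) * of_nat n powr (- x)) * (- 1)) = - e n * of_nat n powr (- x)"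
        using True by simp
      ultimately show ?thesis
        by (metis has_field_derivative_at_within)
    next
      case False
      hence "n = 0 \<or> n = 1" by auto
      thus ?thesis using e(2) by auto
    qed
  qed (use s in auto)
  thus ?thesis unfolding dirichlet_series_def using s
    by (simp add: suminf_minus[OF summable_dirichlet_term[OF e(1)]])
qed

text \<open>A series starting at index \<open>N\<close> decays like N^(-t) along the half-line. This
  gives integrability with N = 2 and the uniqueness of coefficients with
  \<open>N + 1\<close>.\<close>

lemma norm_dirichlet_series_shift_le:
  assumes d: "abs_conv_at d \<sigma>" "\<And>n. 0 < n \<Longrightarrow> n < N \<Longrightarrow> d n = 0" and N: "N > 0"
    and t: "t \<ge> 0" and s: "Re s \<ge> \<sigma>"
  shows "cmod (dirichlet_series d (s + of_real t)) \<le>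
           real N powr (- t) * (\<Sum>n. cmod (d n) * real n powr (- Re s))"
proof -
  have sm: "summable (\<lambda>n. cmod (d n) * real n powr (- Re s))"
    using abs_conv_at_mono[OF d(1) s] by (simp add: abs_conv_at_def)
  have sm': "summable (\<lambda>n. norm (d n * of_nat n powr (- (s + of_real t))))"
    using d t s by (intro summable_norm_dirichlet_term[of _ \<sigma>]) auto
  have "cmod (dirichlet_series d (s + of_real t)) \<le> (\<Sum>n. norm (d n * of_nat n powr (- (s + of_real t))))"
    unfolding dirichlet_series_def by (rule summable_norm[OF sm'])
  also have "\<dots> \<le> (\<Sum>n. real N powr (- t) * (cmod (d n) * real n powr (- Re s)))"
  proof (intro suminf_le sm' summable_mult sm)
    fix n
    show "norm (d n * of_nat n powr (- (s + of_real t))) \<le> real N powr (- t) * (cmod (d n) * real n powr (- Re s))"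
    proof (cases "n \<ge> N")
      case True
      hence "real n powr (- t) \<le> real N powr (- t)" using t N by (intro powr_mono2') auto
      hence "(cmod (d n) * real n powr (- Re s)) * real n powr (- t) \<le>
             (cmod (d n) * real n powr (- Re s)) * real N powr (- t)"
        by (intro mult_left_mono) auto
      moreover have "real n powr (- Re s) * real n powr (- t) = real n powr (- (Re s + t))"
        by (simp flip: powr_add)
      ultimately show ?thesis
        unfolding norm_dirichlet_term by (simp add: mult_ac)
    next
      case False
      thus ?thesis using d(2)[of n] by (cases "n = 0") auto
    qed
  qed
  also have "\<dots> = real N powr (- t) * (\<Sum>n. cmod (d n) * real n powr (- Re s))"
    by (rule suminf_mult[OF sm])
  finally show ?thesis .
qed

text \<open>The fundamental theorem of calculus with the termwise antiderivative \<open>F\<close>.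
  Since \<open>d 1 = 0\<close>, both the integrand and \<open>F\<close> decay like 2^(-t), so the
  integral exists and equals \<open>- F 0\<close>.\<close>

lemma dirichlet_series_integral:
  assumes d: "abs_conv_at d \<sigma>" "d 1 = 0" and s: "Re s > \<sigma>"
  shows "(\<lambda>t. dirichlet_series d (s + of_real t)) integrable_on {0..}"
    and "integral {0..} (\<lambda>t. dirichlet_series d (s + of_real t)) =
           dirichlet_series (\<lambda>n. d n / of_real (ln (real n))) s"
proof -
  define f where "f = (\<lambda>t. dirichlet_series d (s + of_real t))"
  define c where "c = (\<lambda>n. d n / of_real (ln (real n)) :: complex)"
  define F where "F = (\<lambda>t. - dirichlet_series c (s + of_real t))"
  define M where "M = (\<lambda>a. \<Sum>n. cmod (a n) * real n powr (- Re s))"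
  have c: "abs_conv_at c \<sigma>" unfolding c_def by (rule abs_conv_at_over_ln[OF d(1)])
  have bound: "cmod (dirichlet_series a (s + of_real t)) \<le> M a * exp (- ln 2 * t)"
    if "abs_conv_at a \<sigma>" "a 1 = 0" "t \<ge> 0" for a t
    using norm_dirichlet_series_shift_le[OF that(1), of 2 t s] that s
    by (auto simp: M_def powr_def mult_ac less_2_cases_iff)
  have int: "set_integrable lborel {0..} f"
  proof -
    have "(\<lambda>t. exp (- ln 2 * t) :: real) absolutely_integrable_on {0..}"
      by (intro nonnegative_absolutely_integrable_1 integrable_on_exp_minus_to_infinity) auto
    moreover have "(\<lambda>t. indicator {0..} t *\<^sub>R exp (- ln 2 * t) :: real) \<in> borel_measurable lborel"
      unfolding measurable_lborel2
      by (intro borel_measurable_continuous_on_indicator) (auto intro!: continuous_intros)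
    ultimately have "set_integrable lborel {0..} (\<lambda>t. exp (- ln 2 * t) :: real)"
      unfolding set_integrable_def by (simp add: integrable_completion)
    hence "integrable lborel (\<lambda>t. M d * (indicat_real {0..} t *\<^sub>R exp (- ln 2 * t)))"
      unfolding set_integrable_def by (rule integrable_mult_right)
    moreover have "continuous_on {0..} f"
      unfolding f_def
      by (rule continuous_on_compose2[OF continuous_on_dirichlet_series[OF d(1)]])
         (use s in \<open>auto intro!: continuous_intros\<close>)
    hence "(\<lambda>x. indicator {0..} x *\<^sub>R f x) \<in> borel_measurable lborel"
      by (simp, intro borel_measurable_continuous_on_indicator) auto
    ultimately show "set_integrable lborel {0..} f"
      unfolding set_integrable_def
    proof (rule Bochner_Integration.integrable_bound, intro AE_I2)
      fix x :: real
      show "norm (indicat_real {0..} x *\<^sub>R f x) \<le>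
            norm (M d * (indicat_real {0..} x *\<^sub>R exp (- ln 2 * x)))"
        using order_trans[OF bound[OF d, of x] abs_ge_self] by (cases "x \<ge> 0") (auto simp: f_def)
    qed
  qed
  have int': "set_integrable lborel {0<..} f"
    by (rule set_integrable_subset[OF int]) auto
  have F': "(F has_vector_derivative f t) (at t)" if "t \<ge> 0" for t
  proof -
    have "(dirichlet_series c has_field_derivative - dirichlet_series d (s + of_real t)) (at (s + of_real t))"
      unfolding c_def using d s that by (intro dirichlet_series_has_derivative[of _ \<sigma>]) auto
    moreover have "((\<lambda>t. s + of_real t) has_vector_derivative 1) (at t)"
      by (auto intro!: derivative_eq_intros)
    ultimately have "((\<lambda>t. dirichlet_series c (s + of_real t)) has_vector_derivative
             1 * (- dirichlet_series d (s + of_real t))) (at t)"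
      by (rule field_vector_diff_chain_at[unfolded o_def, rotated])
    thus ?thesis unfolding F_def f_def by (auto dest: has_vector_derivative_minus)
  qed
  have lim: "(F \<longlongrightarrow> 0) at_top"
  proof (rule Lim_null_comparison)
    have "filterlim (\<lambda>t::real. - ln 2 * t) at_bot at_top"
      by (rule filterlim_tendsto_neg_mult_at_bot[OF tendsto_const _ filterlim_ident]) auto
    hence "((\<lambda>t::real. exp (- ln 2 * t)) \<longlongrightarrow> 0) at_top"
      by (rule filterlim_compose[OF exp_at_bot])
    from tendsto_mult_right_zero[OF this]
    show "((\<lambda>t. M c * exp (- ln 2 * t)) \<longlongrightarrow> 0) at_top" .
    show "\<forall>\<^sub>F t in at_top. norm (F t) \<le> M c * exp (- ln 2 * t)"
      using eventually_ge_at_top[of 0]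
      by eventually_elim (use bound[OF c] d(2) in \<open>simp add: F_def c_def\<close>)
  qed
  have "(LBINT t=ereal 0..\<infinity>. f t) = 0 - F 0"
  proof (rule interval_integral_FTC_integrable)
    show "set_integrable lborel (einterval (ereal 0) \<infinity>) f"
      using int' by simp
    show "((F \<circ> real_of_ereal) \<longlongrightarrow> 0) (at_left \<infinity>)"
      using lim by (simp add: ereal_tendsto_simps)
    have "isCont F 0" using has_vector_derivative_continuous[OF F'[of 0]] by simp
    hence "(F \<longlongrightarrow> F 0) (at_right 0)"
      by (metis continuous_at_imp_continuous_at_within continuous_within)
    thus "((F \<circ> real_of_ereal) \<longlongrightarrow> F 0) (at_right (ereal 0))"
      by (simp add: ereal_tendsto_simps)
    show "isCont f x" if "ereal 0 < ereal x" for x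
    proof -
      have "isCont (dirichlet_series d) (s + of_real x)"
        using continuous_on_interior[OF continuous_on_dirichlet_series[OF d(1)]] that s
        by (simp add: interior_open open_halfspace_Re_gt)
      hence "((\<lambda>t. dirichlet_series d (s + of_real t)) \<longlongrightarrow> dirichlet_series d (s + of_real x)) (at x)"
        by (rule isCont_tendsto_compose) (auto intro!: tendsto_intros)
      thus ?thesis by (simp add: isCont_def f_def)
    qed
  qed (use F' in auto)
  also have "(LBINT t=ereal 0..\<infinity>. f t) = (LINT t:{0<..}|lborel. f t)"
    by (simp add: interval_lebesgue_integral_def)
  also have "\<dots> = (LINT t:{0..}|lborel. f t)"
  proof (rule set_integral_cong_set)
    show "set_borel_measurable lborel {0<..} f" "set_borel_measurable lborel {0..} f"
      using int int'
      by (auto simp: set_borel_measurable_def set_integrable_def)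
    show "AE x in lborel. (x \<in> {0..}) = (x \<in> {0::real<..})"
      using AE_lborel_singleton[of 0] by eventually_elim auto
  qed
  also have "\<dots> = integral {0..} f" by (rule set_borel_integral_eq_integral(2)[OF int])
  finally show "integral {0..} (\<lambda>t. dirichlet_series d (s + of_real t)) =
      dirichlet_series (\<lambda>n. d n / of_real (ln (real n))) s"
    by (simp add: f_def F_def c_def)
  show "(\<lambda>t. dirichlet_series d (s + of_real t)) integrable_on {0..}"
    using set_borel_integral_eq_integral(1)[OF int] by (simp add: f_def)
qed

text \<open>Absolute summability over all pairs permits regrouping by the product N = m n. Vanishing
  at 0 restricts the indices to positive ones, where (m, n) -> (m n, n) is a bijection onto the
  pairs with \<open>n dvd N\<close>.\<close>

lemma dirichlet_product:
  fixes f g :: "nat \<Rightarrow> 'a :: {real_normed_field, banach}"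
  assumes f: "summable (\<lambda>n. norm (f n))" "f 0 = 0" and g: "summable (\<lambda>n. norm (g n))" "g 0 = 0"
  shows "(\<lambda>N. \<Sum>n | n dvd N. f (N div n) * g n) sums (suminf f * suminf g)"
proof -
  let ?I = "{1..} :: nat set"
  have hs: "(h has_sum suminf h) ?I" if "summable (\<lambda>n. norm (h n))" "h 0 = 0" for h :: "nat \<Rightarrow> 'a"
  proof -
    have "(h has_sum suminf h) UNIV"
      by (rule norm_summable_imp_has_sum[OF that(1) summable_sums[OF summable_norm_cancel[OF that(1)]]])
    thus ?thesis using that(2)
      by (subst has_sum_cong_neutral[where T = UNIV and g = h]) (auto simp: not_le)
  qed
  have "(\<lambda>(m, n). norm (f m) * norm (g n)) summable_on (?I \<times> ?I)"
  proof (rule summable_on_SigmaI)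
    have "(\<lambda>n. norm (h n)) summable_on ?I" if "summable (\<lambda>n. norm (h n))" for h :: "nat \<Rightarrow> 'a"
      by (rule summable_on_subset_banach[OF norm_summable_imp_summable_on]) (use that in auto)
    note sn = this[OF f(1)] this[OF g(1)]
    show "((\<lambda>n. case (m, n) of (m, n) \<Rightarrow> norm (f m) * norm (g n)) has_sum norm (f m) * infsum (\<lambda>n. norm (g n)) ?I) ?I" for m
      using sn(2) by (auto intro!: has_sum_cmult_right)
    show "(\<lambda>m. norm (f m) * infsum (\<lambda>n. norm (g n)) ?I) summable_on ?I"
      by (intro summable_on_cmult_left sn)
  qed auto
  hence "(\<lambda>(m, n). f m * g n) summable_on (?I \<times> ?I)"
    by - (rule abs_summable_summable, simp add: case_prod_unfold norm_mult)
  hence pr: "((\<lambda>(m, n). f m * g n) has_sum (suminf f * suminf g)) (?I \<times> ?I)"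
    using hs[OF f] hs[OF g]
    by (intro has_sum_SigmaI[where g = "\<lambda>m. f m * suminf g"]) (auto intro!: has_sum_cmult_right has_sum_cmult_left)
  let ?S = "Sigma ?I (\<lambda>N. {n. n dvd N})"
  have bij: "bij_betw (\<lambda>(N, n). (N div n, n)) ?S (?I \<times> ?I)"
    by (rule bij_betwI[where g = "\<lambda>(m, n). (m * n, n)"])
       (auto simp: Suc_le_eq elim!: dvdE)
  have "((\<lambda>(N, n). f (N div n) * g n) has_sum (suminf f * suminf g)) ?S"
    using has_sum_reindex_bij_betw[OF bij, of "\<lambda>(m, n). f m * g n" "suminf f * suminf g"] pr
    by (simp add: case_prod_unfold)
  hence "((\<lambda>N. \<Sum>n | n dvd N. f (N div n) * g n) has_sum (suminf f * suminf g)) ?I"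
    by (rule has_sum_SigmaD) (auto intro!: has_sum_finite)
  \<comment> \<open>Index 0 adds nothing: every \<open>n\<close> divides 0, and a sum over an
    infinite set is 0.\<close>
  hence "((\<lambda>N. \<Sum>n | n dvd N. f (N div n) * g n) has_sum (suminf f * suminf g)) UNIV"
    by (subst (asm) has_sum_cong_neutral[where T = UNIV and g = "\<lambda>N. \<Sum>n | n dvd N. f (N div n) * g n"]) (auto simp: not_le)
  thus ?thesis by (rule has_sum_imp_sums)
qed

text \<open>At \<open>N = 0\<close> the index set is infinite, so the sum is 0 there.\<close>

definition dirichlet_conv :: "(nat \<Rightarrow> complex) \<Rightarrow> (nat \<Rightarrow> complex) \<Rightarrow> nat \<Rightarrow> complex" where
  "dirichlet_conv a e N = (\<Sum>n | n dvd N. a (N div n) * e n)"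

lemma abs_conv_at_dirichlet_conv:
  assumes "abs_conv_at a \<sigma>" "abs_conv_at e \<sigma>"
  shows "abs_conv_at (dirichlet_conv a e) \<sigma>"
proof -
  have "summable (\<lambda>N. \<Sum>n | n dvd N. (cmod (a (N div n)) * real (N div n) powr (-\<sigma>)) * (cmod (e n) * real n powr (-\<sigma>)))"
    using dirichlet_product[of "\<lambda>n. cmod (a n) * real n powr (-\<sigma>)" "\<lambda>n. cmod (e n) * real n powr (-\<sigma>)"] assms
    by (simp add: abs_conv_at_def sums_iff)
  thus ?thesis unfolding abs_conv_at_def
  proof (rule summable_comparison_test'[of _ 0])
    fix N
    have "cmod (dirichlet_conv a e N) * real N powr (-\<sigma>) \<le> (\<Sum>n | n dvd N. cmod (a (N div n)) * cmod (e n)) * real N powr (-\<sigma>)"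
      unfolding dirichlet_conv_def
      by (intro mult_right_mono sum_norm_le) (auto simp: norm_mult)
    also have "\<dots> = (\<Sum>n | n dvd N. (cmod (a (N div n)) * real (N div n) powr (-\<sigma>)) * (cmod (e n) * real n powr (-\<sigma>)))"
      unfolding sum_distrib_right
    proof (intro sum.cong refl)
      fix n assume "n \<in> {n. n dvd N}"
      hence "real N = real (N div n) * real n" by (simp flip: of_nat_mult)
      hence "real N powr (-\<sigma>) = real (N div n) powr (-\<sigma>) * real n powr (-\<sigma>)"
        by (simp add: powr_mult)
      thus "cmod (a (N div n)) * cmod (e n) * real N powr (-\<sigma>) =
            (cmod (a (N div n)) * real (N div n) powr (-\<sigma>)) * (cmod (e n) * real n powr (-\<sigma>))" by simp
    qed
    finally show "norm (cmod (dirichlet_conv a e N) * real N powr (-\<sigma>)) \<le> \<dots>" by simp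
  qed
qed

lemma dirichlet_series_mult:
  assumes "abs_conv_at a \<sigma>" "abs_conv_at e \<sigma>" "Re s \<ge> \<sigma>"
  shows "dirichlet_series a s * dirichlet_series e s = dirichlet_series (dirichlet_conv a e) s"
proof -
  have "(\<lambda>N. \<Sum>n | n dvd N. (a (N div n) * of_nat (N div n) powr (-s)) * (e n * of_nat n powr (-s)))
           sums (dirichlet_series a s * dirichlet_series e s)"
    unfolding dirichlet_series_def
    using assms by (intro dirichlet_product summable_norm_dirichlet_term[of _ \<sigma>]) auto
  also have "(\<lambda>N. \<Sum>n | n dvd N. (a (N div n) * of_nat (N div n) powr (-s)) * (e n * of_nat n powr (-s))) =
             (\<lambda>N. dirichlet_conv a e N * of_nat N powr (-s))"
    unfolding dirichlet_conv_def sum_distrib_right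
  proof (intro ext sum.cong refl)
    fix N n :: nat assume "n \<in> {n. n dvd N}"
    hence N: "(of_nat N :: complex) = of_real (real (N div n)) * of_real (real n)" by (simp flip: of_nat_mult)
    have "(of_nat N :: complex) powr (-s) = of_nat (N div n) powr (-s) * of_nat n powr (-s)"
      unfolding N by (subst powr_times_real) auto
    thus "(a (N div n) * of_nat (N div n) powr (-s)) * (e n * of_nat n powr (-s)) =
          a (N div n) * e n * of_nat N powr (-s)" by simp
  qed
  finally show ?thesis by (simp add: dirichlet_series_def sums_iff)
qed

text \<open>If the coefficients below \<open>N\<close> agree, the difference of the
  \<open>N\<close>-th terms equals minus a series starting at \<open>N + 1\<close>. It decays like
  N^(-t) on one side and (N+1)^(-t) on the other, so it vanishes.\<close>

lemma dirichlet_series_unique: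
  assumes a: "abs_conv_at a \<sigma>" and b: "abs_conv_at b \<sigma>"
    and eq: "\<And>s. Re s > \<tau> \<Longrightarrow> dirichlet_series a s = dirichlet_series b s"
    and "n > 0"
  shows "a n = b n"
  using \<open>n > 0\<close>
proof (induction n rule: less_induct)
  case (less N)
  define d where "d = (\<lambda>n. if n = N then 0 else a n - b n)"
  define D where "D = a N - b N"
  define x where "x = max \<sigma> \<tau> + 1"
  define M where "M = (\<Sum>n. cmod (d n) * real n powr (- x))"
  have x: "x > \<sigma>" "x > \<tau>" by (auto simp: x_def)
  have d: "abs_conv_at d \<sigma>"
    unfolding abs_conv_at_def
  proof (rule summable_comparison_test'[of _ 0])
    show "summable (\<lambda>n. cmod (a n) * real n powr (- \<sigma>) + cmod (b n) * real n powr (- \<sigma>))"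
      using a b by (intro summable_add) (auto simp: abs_conv_at_def)
    have "cmod (d n) \<le> cmod (a n) + cmod (b n)" for n
      by (auto simp: d_def norm_triangle_ineq4)
    from mult_right_mono[OF this] show "norm (cmod (d n) * real n powr (- \<sigma>)) \<le>
        cmod (a n) * real n powr (- \<sigma>) + cmod (b n) * real n powr (- \<sigma>)" for n
      by (simp add: distrib_right)
  qed
  have "cmod D * real N powr (- x) \<le> M * exp (- (ln (real N + 1) - ln (real N)) * t)" if t: "t \<ge> 0" for t
  proof -
    define s :: complex where "s = of_real x + of_real t"
    have s: "Re s > \<sigma>" "Re s > \<tau>" using x t by (auto simp: s_def)
    have sm: "summable (\<lambda>n. e n * of_nat n powr (- s))" if "abs_conv_at e \<sigma>" for e
      using s by (intro summable_dirichlet_term[OF that]) auto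
    have "(\<lambda>n. a n * of_nat n powr (-s) - b n * of_nat n powr (-s) - d n * of_nat n powr (-s)) sums
             (dirichlet_series a s - dirichlet_series b s - dirichlet_series d s)"
      unfolding dirichlet_series_def by (intro sums_diff summable_sums sm a b d)
    also have "(\<lambda>n. a n * of_nat n powr (-s) - b n * of_nat n powr (-s) - d n * of_nat n powr (-s)) =
               (\<lambda>n. if n = N then D * of_nat N powr (-s) else 0)"
      by (auto simp: d_def D_def algebra_simps)
    finally have "D * of_nat N powr (-s) = - dirichlet_series d s"
      using sums_unique2[OF _ sums_single] eq[OF s(2)] by force
    hence "cmod D * real N powr (- (x + t)) = cmod (dirichlet_series d s)"
      using norm_dirichlet_term[of "\<lambda>_. D" N s] by (simp add: s_def)
    also have "\<dots> \<le> real (N + 1) powr (- t) * M"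
      using norm_dirichlet_series_shift_le[OF d, of "N + 1" t "of_real x"] less x t
      by (auto simp: s_def M_def d_def)
    finally have "cmod D * real N powr (- (x + t)) * real N powr t \<le> real (N + 1) powr (- t) * M * real N powr t"
      by (rule mult_right_mono) auto
    hence "cmod D * (real N powr (- (x + t)) * real N powr t) \<le> M * (real (N + 1) powr (- t) * real N powr t)"
      by (simp only: mult_ac)
    also have "real N powr (- (x + t)) * real N powr t = real N powr (- x)"
      by (simp flip: powr_add)
    also have "real (N + 1) powr (- t) * real N powr t = exp (- (ln (real N + 1) - ln (real N)) * t)"
      using less.prems by (simp add: powr_def algebra_simps flip: exp_add)
    finally show ?thesis .
  qed
  hence ev: "\<forall>\<^sub>F t in at_top. cmod D * real N powr (- x) \<le> M * exp (- (ln (real N + 1) - ln (real N)) * t)"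
    by (intro eventually_mono[OF eventually_ge_at_top[of 0]]) auto
  have "filterlim (\<lambda>t::real. - (ln (real N + 1) - ln (real N)) * t) at_bot at_top"
    using less.prems by (intro filterlim_tendsto_neg_mult_at_bot[OF tendsto_const _ filterlim_ident]) auto
  hence "((\<lambda>t. exp (- (ln (real N + 1) - ln (real N)) * t)) \<longlongrightarrow> 0) at_top"
    by (rule filterlim_compose[OF exp_at_bot])
  from tendsto_lowerbound[OF tendsto_mult_right_zero[OF this] ev]
  have "cmod D * real N powr (- x) \<le> 0" by simp
  moreover have "real N powr (- x) > 0" using less.prems by simp
  ultimately have "D = 0" by (simp add: mult_le_0_iff)
  thus ?case by (simp add: D_def)
qed

section \<open>Elements of \<open>H2\<close> as Dirichlet series and the coefficients of the
  Volterra operator\<close>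

lemma H2_abs_conv_at:
  assumes "a \<in> H2"
  shows "abs_conv_at a 2"
proof -
  have sm: "summable (\<lambda>n. (cmod (a n))\<^sup>2)" using assms by (simp add: H2_def)
  \<comment> \<open>Square-summable coefficients are bounded, which yields absolute convergence at
    2.\<close>
  define M where "M = sqrt (\<Sum>n. (cmod (a n))\<^sup>2)"
  have M: "cmod (a n) \<le> M" for n
    unfolding M_def using sum_le_suminf[OF sm, of "{n}"] by (intro real_le_rsqrt) auto
  show ?thesis
    unfolding abs_conv_at_def
  proof (rule summable_comparison_test'[of _ 0])
    show "summable (\<lambda>n. M * real n powr (-2))"
      by (intro summable_mult) (simp add: summable_real_powr_iff)
    show "norm (cmod (a n) * real n powr (-2)) \<le> M * real n powr (-2)" for n
      using M by (auto intro!: mult_right_mono)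
  qed
qed

lemma H2_norm_square:
  assumes "a \<in> H2"
  shows "(H2_norm a)\<^sup>2 = (\<Sum>n. (cmod (a n))\<^sup>2)"
  using assms unfolding H2_norm_def H2_def by (auto intro!: suminf_nonneg)

text \<open>The value is 0 at \<open>n = 0\<close> and \<open>n = 1\<close>, where the denominator vanishes.\<close>

definition volterra_coeff :: "(nat \<Rightarrow> complex) \<Rightarrow> (nat \<Rightarrow> complex) \<Rightarrow> nat \<Rightarrow> complex" where
  "volterra_coeff e a n = dirichlet_conv a e n / of_real (ln (real n))"

text \<open>Here \<open>e\<close> holds the coefficients of -g'. Multiplication by g' becomes a
  Dirichlet convolution, integration a division by ln n, and the minus sign of g' cancels the one in
  \<open>volterra\<close>.\<close>

lemma volterra_eq_dirichlet_series:
  assumes e: "abs_conv_at e \<sigma>" "e 1 = 0" and a: "abs_conv_at a \<sigma>" and s: "Re s > \<sigma>"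
    and g: "g = dirichlet_series (\<lambda>n. e n / of_real (ln (real n)))"
  shows "volterra_integrand g (dirichlet_series a) s integrable_on {0..}"
    and "volterra g (dirichlet_series a) s = dirichlet_series (volterra_coeff e a) s"
proof -
  let ?d = "dirichlet_conv a e"
  have d: "abs_conv_at ?d \<sigma>" by (rule abs_conv_at_dirichlet_conv[OF a e(1)])
  have d1: "?d 1 = 0" using e(2) by (simp add: dirichlet_conv_def)
  have eq: "volterra_integrand g (dirichlet_series a) s t = - dirichlet_series ?d (s + of_real t)"
    if "t \<in> {0..}" for t
  proof -
    have t: "Re (s + of_real t) > \<sigma>" using that s by simp
    have "deriv g (s + of_real t) = - dirichlet_series e (s + of_real t)"
      unfolding g by (rule DERIV_imp_deriv[OF dirichlet_series_has_derivative[OF e t]])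
    thus ?thesis
      using dirichlet_series_mult[OF a e(1) less_imp_le[OF t]] by (simp add: volterra_integrand_def)
  qed
  note int = dirichlet_series_integral[OF d d1 s]
  show "volterra_integrand g (dirichlet_series a) s integrable_on {0..}"
    using integrable_neg[OF int(1)] by (rule integrable_eq) (simp add: eq)
  have "volterra g (dirichlet_series a) s = - integral {0..} (\<lambda>t. - dirichlet_series ?d (s + of_real t))"
    unfolding volterra_def by (intro arg_cong[where f = uminus] integral_cong eq)
  also have "\<dots> = dirichlet_series (volterra_coeff e a) s"
    using int(2) by (simp add: volterra_coeff_def[abs_def])
  finally show "volterra g (dirichlet_series a) s = dirichlet_series (volterra_coeff e a) s" .
qed

theorem theorem3p3:
  fixes lam :: real and \<psi> :: "nat \<Rightarrow> real" and g :: "complex \<Rightarrow> complex"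
  assumes "0 < lam"
    and "completely_multiplicative \<psi>"
    and "\<And>p::nat. prime p \<Longrightarrow> \<psi> p = lam * inverse (real p) * ln (real p)"
    and "g = dirichlet_series (\<lambda>n. if n \<ge> 2 then of_real (\<psi> n / ln (real n)) else 0)"
  shows "volterra_bounded_on_H2 g \<longleftrightarrow> lam \<le> 1"
proof -
  define e where "e = (\<lambda>n. if n \<ge> 2 then complex_of_real (\<psi> n) else 0)"
  have e1: "e 1 = 0" by (simp add: e_def)
  have g: "g = dirichlet_series (\<lambda>n. e n / of_real (ln (real n)))"
    unfolding assms(4) by (intro arg_cong[where f = dirichlet_series]) (auto simp: e_def)
  have \<psi>p: "\<psi> p = lam * ln (real p) / real p" if "prime p" for p
    using assms(3)[OF that] by (simp add: field_simps)
  have nnp: "\<psi> p \<ge> 0" if "prime p" for p using that \<psi>p assms(1) by simp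
  have nn: "\<psi> n \<ge> 0" if "n > 0" for n
    by (rule completely_multiplicative_nonneg[OF assms(2) nnp that])
  \<comment> \<open>For large lambda the function \<open>\<psi>\<close> need not be bounded; a
    polynomial bound is enough for some half-plane of absolute convergence.\<close>
  have growth: "\<psi> n \<le> real n powr lam" if "n > 0" for n
  proof (rule completely_multiplicative_mono[OF assms(2) completely_multiplicative_powr nnp _ that])
    fix p :: nat assume p: "prime p"
    hence p1: "real p \<ge> 1" using prime_ge_1_nat[of p] by simp
    have "\<psi> p \<le> lam * ln (real p) / 1"
      unfolding \<psi>p[OF p] using p p1 assms(1) by (intro divide_left_mono) auto
    also have "\<dots> \<le> exp (lam * ln (real p))" using exp_ge_add_one_self[of "lam * ln (real p)"] by linarith
    also have "\<dots> = real p powr lam" using p1 by (simp add: powr_def)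
    finally show "\<psi> p \<le> real p powr lam" .
  qed
  \<comment> \<open>Leaves n^(-2) after the growth bound, and exceeds the abscissa 2 used for
    \<open>H2\<close>.\<close>
  define \<sigma> where "\<sigma> = lam + 2"
  have e: "abs_conv_at e \<sigma>"
    unfolding abs_conv_at_def
  proof (rule summable_comparison_test'[of _ 0])
    show "summable (\<lambda>n. real n powr (-2))" by (simp add: summable_real_powr_iff)
    show "norm (cmod (e n) * real n powr (- \<sigma>)) \<le> real n powr (-2)" for n
    proof (cases "n \<ge> 2")
      case True
      hence "cmod (e n) \<le> real n powr lam" using growth[of n] nn[of n] by (simp add: e_def)
      hence "cmod (e n) * real n powr (- \<sigma>) \<le> real n powr lam * real n powr (- \<sigma>)"
        by (intro mult_right_mono) auto
      also have "\<dots> = real n powr (-2)" by (simp add: \<sigma>_def flip: powr_add)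
      finally show ?thesis by simp
    qed (auto simp: e_def)
  qed
  have H2\<sigma>: "abs_conv_at a \<sigma>" if "a \<in> H2" for a
    using abs_conv_at_mono[OF H2_abs_conv_at[OF that]] assms(1) by (simp add: \<sigma>_def)
  note volt = volterra_eq_dirichlet_series[OF e e1 H2\<sigma> _ g]
  have conv: "dirichlet_conv a e N = (\<Sum>n | n dvd N \<and> 2 \<le> n. a (N div n) * of_real (\<psi> n))" if "N > 0" for a N
    unfolding dirichlet_conv_def e_def using that
    by (intro sum.mono_neutral_cong_right) auto
  have coeff01: "volterra_coeff e a N = 0" if "N < 2" for a N
  proof -
    have "N = 0 \<or> N = 1" using that by auto
    thus ?thesis by (auto simp: volterra_coeff_def)
  qed
  show ?thesis
  proof
    assume "volterra_bounded_on_H2 g"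
    then obtain C where C: "\<And>a. a \<in> H2 \<Longrightarrow> \<exists>b\<in>H2. H2_norm b \<le> C * H2_norm a \<and>
       (\<exists>\<sigma>. \<forall>s. Re s > \<sigma> \<longrightarrow>
          volterra_integrand g (dirichlet_series a) s integrable_on {0..} \<and>
          volterra g (dirichlet_series a) s = dirichlet_series b s)"
      unfolding volterra_bounded_on_H2_def by blast
    show "lam \<le> 1"
    \<comment> \<open>The sign of \<open>C\<close> is not known, but only its square enters.\<close>
    proof (rule lambda_le_1_if_bounded[OF assms(1,2) \<psi>p, where C = "\<bar>C\<bar>"])
      fix Q :: nat assume Q: "Q > 0"
      have finQ: "finite {N. N dvd Q}" using Q by simp
      define a where "a = (\<lambda>n. if n dvd Q then 1 else 0 :: complex)"
      have sums: "(\<lambda>n. (cmod (a n))\<^sup>2) sums (\<Sum>n | n dvd Q. (cmod (a n))\<^sup>2)"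
        by (rule sums_finite[OF finQ]) (auto simp: a_def)
      hence aH: "a \<in> H2" using Q by (auto simp: H2_def sums_iff a_def)
      have na: "(H2_norm a)\<^sup>2 = real (card {N. N dvd Q})"
        unfolding H2_norm_square[OF aH] using sums by (simp add: sums_iff a_def)
      obtain b \<tau> where b: "b \<in> H2" "H2_norm b \<le> C * H2_norm a"
        "\<And>s. Re s > \<tau> \<Longrightarrow> volterra g (dirichlet_series a) s = dirichlet_series b s"
        using C[OF aH] by blast
      \<comment> \<open>Boundedness provides \<open>b\<close> only through the function it
        represents; uniqueness identifies its coefficients.\<close>
      have beq: "b N = volterra_coeff e a N" if "N > 0" for N
      proof (rule dirichlet_series_unique[OF H2\<sigma>[OF b(1)] _ _ that])
        show "abs_conv_at (volterra_coeff e a) \<sigma>"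
          unfolding volterra_coeff_def[abs_def]
          by (intro abs_conv_at_over_ln abs_conv_at_dirichlet_conv H2\<sigma> aH e)
        show "dirichlet_series b s = dirichlet_series (volterra_coeff e a) s" if "max \<tau> \<sigma> < Re s" for s
          using b(3)[of s] volt(2)[OF aH, of s] that by simp
      qed
      have "(\<Sum>N | N dvd Q. ((\<Sum>n | n dvd N \<and> 2 \<le> n. \<psi> n) / ln (real N))\<^sup>2) = (\<Sum>N | N dvd Q. (cmod (b N))\<^sup>2)"
      proof (intro sum.cong refl)
        fix N assume "N \<in> {N. N dvd Q}"
        hence N: "N > 0" "N dvd Q" using Q by (auto intro!: Nat.gr0I)
        \<comment> \<open>Hence the test function is 1 at every quotient that occurs in the
          convolution.\<close>
        have "N div n dvd Q" if "n dvd N" for n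
          using dvd_trans[OF _ N(2)] that by (metis dvd_div_mult_self dvd_triv_left)
        hence "dirichlet_conv a e N = (\<Sum>n | n dvd N \<and> 2 \<le> n. of_real (\<psi> n))"
          unfolding conv[OF N(1)] a_def by (intro sum.cong) auto
        hence "b N = of_real ((\<Sum>n | n dvd N \<and> 2 \<le> n. \<psi> n) / ln (real N))"
          by (simp add: beq[OF N(1)] volterra_coeff_def)
        thus "((\<Sum>n | n dvd N \<and> 2 \<le> n. \<psi> n) / ln (real N))\<^sup>2 = (cmod (b N))\<^sup>2"
          by (simp only: norm_of_real power2_abs)
      qed
      also have "\<dots> \<le> (H2_norm b)\<^sup>2"
        unfolding H2_norm_square[OF b(1)] using b(1) finQ by (intro sum_le_suminf) (auto simp: H2_def)
      also have "\<dots> \<le> (C * H2_norm a)\<^sup>2"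
        using b(1,2) by (intro power_mono) (auto simp: H2_norm_def H2_def intro!: suminf_nonneg)
      also have "\<dots> = \<bar>C\<bar>\<^sup>2 * real (card {N. N dvd Q})" by (simp add: power_mult_distrib na)
      finally show "(\<Sum>N | N dvd Q. ((\<Sum>n | n dvd N \<and> 2 \<le> n. \<psi> n) / ln (real N))\<^sup>2) \<le> \<bar>C\<bar>\<^sup>2 * real (card {N. N dvd Q})" .
    qed auto
  next
    assume "lam \<le> 1"
    obtain C where C: "C > 0"
      "\<And>\<alpha> X. (\<And>n. \<alpha> n \<ge> 0) \<Longrightarrow> (\<Sum>N\<in>{2..X}. ((\<Sum>n | n dvd N \<and> 2 \<le> n. \<alpha> (N div n) * psi1 n) / ln (real N))\<^sup>2)
        \<le> C * (\<Sum>m\<in>{1..X}. (\<alpha> m)\<^sup>2)"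
      using volterra_coefficients_bounded by blast
    \<comment> \<open>The only use of \<open>lam \<le> 1\<close>.\<close>
    have le1: "\<psi> n \<le> psi1 n" if "n > 0" for n
    proof (rule completely_multiplicative_mono[OF assms(2) completely_multiplicative_mult_ext nnp _ that])
      fix p :: nat assume p: "prime p"
      have "lam * (ln (real p) / real p) \<le> 1 * (ln (real p) / real p)"
        using p \<open>lam \<le> 1\<close> by (intro mult_right_mono) auto
      thus "\<psi> p \<le> psi1 p" using p by (simp add: \<psi>p)
    qed
    show "volterra_bounded_on_H2 g"
      unfolding volterra_bounded_on_H2_def
    \<comment> \<open>The root appears because \<open>C\<close> bounds the squared norms.\<close>
    proof (intro exI[of _ "sqrt C"] ballI)
      fix a assume a: "a \<in> H2"
      define b where "b = volterra_coeff e a"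
      have bound: "(\<Sum>N<X. (cmod (b N))\<^sup>2) \<le> C * (H2_norm a)\<^sup>2" for X
      proof -
        have "(\<Sum>N<X. (cmod (b N))\<^sup>2) \<le> (\<Sum>N\<in>{0,1} \<union> {2..X}. (cmod (b N))\<^sup>2)"
          by (intro sum_mono2) auto
        also have "\<dots> = (\<Sum>N\<in>{2..X}. (cmod (b N))\<^sup>2)"
          by (rule sum.mono_neutral_right) (auto simp: b_def coeff01)
        also have "\<dots> \<le> (\<Sum>N\<in>{2..X}. ((\<Sum>n | n dvd N \<and> 2 \<le> n. cmod (a (N div n)) * psi1 n) / ln (real N))\<^sup>2)"
        proof (intro sum_mono power_mono)
          fix N assume N: "N \<in> {2..X}"
          have "cmod (dirichlet_conv a e N) \<le> (\<Sum>n | n dvd N \<and> 2 \<le> n. cmod (a (N div n)) * psi1 n)"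
          proof (subst conv, use N in simp, rule sum_norm_le)
            fix n assume "n \<in> {n. n dvd N \<and> 2 \<le> n}"
            thus "cmod (a (N div n) * of_real (\<psi> n)) \<le> cmod (a (N div n)) * psi1 n"
              using nn[of n] le1[of n] by (auto simp: norm_mult intro!: mult_left_mono)
          qed
          thus "cmod (b N) \<le> (\<Sum>n | n dvd N \<and> 2 \<le> n. cmod (a (N div n)) * psi1 n) / ln (real N)"
            using N by (simp add: b_def volterra_coeff_def norm_divide divide_right_mono)
        qed auto
        also have "\<dots> \<le> C * (\<Sum>m\<in>{1..X}. (cmod (a m))\<^sup>2)" by (rule C(2)) auto
        also have "\<dots> \<le> C * (H2_norm a)\<^sup>2"
          unfolding H2_norm_square[OF a] using a C(1)
          by (intro mult_left_mono sum_le_suminf) (auto simp: H2_def)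
        finally show ?thesis .
      qed
      have sm: "summable (\<lambda>N. (cmod (b N))\<^sup>2)"
        by (rule summableI_nonneg_bounded[OF _ bound]) auto
      have bH: "b \<in> H2" using sm by (simp add: H2_def b_def coeff01)
      have "H2_norm b = sqrt (\<Sum>N. (cmod (b N))\<^sup>2)" by (simp add: H2_norm_def)
      also have "\<dots> \<le> sqrt (C * (H2_norm a)\<^sup>2)"
        by (intro real_sqrt_le_mono suminf_le_const[OF sm bound])
      also have "\<dots> = sqrt C * H2_norm a"
        using a by (simp add: real_sqrt_mult H2_norm_def H2_def suminf_nonneg)
      finally have "H2_norm b \<le> sqrt C * H2_norm a" .
      moreover have "\<forall>s. Re s > \<sigma> \<longrightarrow>
          volterra_integrand g (dirichlet_series a) s integrable_on {0..} \<and>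
          volterra g (dirichlet_series a) s = dirichlet_series b s"
        unfolding b_def using volt[OF a] by blast
      ultimately show "\<exists>b\<in>H2. H2_norm b \<le> sqrt C * H2_norm a \<and> (\<exists>\<sigma>. \<forall>s. Re s > \<sigma> \<longrightarrow>
          volterra_integrand g (dirichlet_series a) s integrable_on {0..} \<and>
          volterra g (dirichlet_series a) s = dirichlet_series b s)"
        using bH by blast
    qed
  qed
qed

end
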